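(* Define $$u_n=\sum_{k=0}^n\binom nk^2\binom{n+k}n\binom{2k}n\qquad(n=0,1,2,\dots).$$ Then for all $n\ge 0$ one also has $$u_n=\sum_{k=0}^n(-1)^{n-k}\binom{3n+1}{n-k}\binom{n+k}{n}^3,$$ and, with the convention $u_{-1}=0$, the sequence satisfies $u_0=1$ and $$(n+1)^3u_{n+1}=(2n+1)(13n^2+13n+4)u_n+3n(3n-1)(3n+1)u_{n-1}\qquad\text{for } n=0,1,2,\dots.$$ Moreover, put $$x(v)=\frac{v}{1+5v+8v^2},\qquad z(v)=\frac{x(v)}{(1+x(v))^2}=\frac{v(1+5v+8v^2)}{(1+2v)^2(1+4v)^2}.$$ Then there exists $\varepsilon>0$ such that for all complex $v$ with $|v|<\varepsilon$ (both outer series being convergent) $$\sum_{n=0}^\infty\binom{2n}n z(v)^n\left(\sum_{k=0}^n\binom nk\binom{n+k}n\binom{2k}k x(v)^k\right)=\frac{1+2v}{1+4v}\sum_{n=0}^\infty u_n\left(\frac v{(1+4v)^3}\right)^n.$$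
   Context: Binomial coefficients $\binom{a}{b}$ with nonnegative integers $a<b$ are equal to $0$ (so $\binom{2k}{n}=0$ when $2k<n$). *)

theory Defs
  imports Complex_Main
begin

definition u :: "nat \<Rightarrow> int" where
  "u n = (\<Sum>k=0..n. int ((n choose k)^2 * ((n + k) choose n) * ((2 * k) choose n)))"

definition x_of :: "complex \<Rightarrow> complex" where
  "x_of v = v / (1 + 5 * v + 8 * v^2)"

definition z_of :: "complex \<Rightarrow> complex" where
  "z_of v = x_of v / (1 + x_of v)^2"

definition lhs_term :: "complex \<Rightarrow> nat \<Rightarrow> complex" where
  "lhs_term v n = of_nat ((2 * n) choose n) * z_of v ^ n *
     (\<Sum>k=0..n. of_nat ((n choose k) * ((n + k) choose n) * ((2 * k) choose k)) * x_of v ^ k)"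

definition rhs_term :: "complex \<Rightarrow> nat \<Rightarrow> complex" where
  "rhs_term v n = of_int (u n) * (v / (1 + 4 * v)^3) ^ n"

end

theory Submission
  imports Defs "HOL-Complex_Analysis.Complex_Analysis"
begin

text \<open>
  Both sums for \<open>u n\<close> satisfy the same second-order recurrence, by Zeilberger certificates; inverse
  factorials extended by \<open>0\<close> to the negative integers make these certificates polynomial.

  For the generating function put \<open>z = x / (1 + x)\<^sup>2\<close> and let \<open>c n k\<close> be the coefficient of
  \<open>x\<^sup>k z\<^sup>n\<close> on the left-hand side. Write \<open>\<langle>Q\<rangle>\<close> for the formal power series
  \<open>\<Sum>n k. Q n k * c n k * x ^ (n + k) / (1 + x) ^ (2 * n + 1)\<close>, with \<open>Q\<close> polynomial in \<open>x, n, k\<close>.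
  The hypergeometric recurrences of \<open>c\<close> in \<open>n\<close> and in \<open>k\<close> are linear relations between such series,
  and \<open>\<theta> = x d/dx\<close> acts on them. Modulo these relations one only obtains an equation of order five for
  \<open>A = \<langle>1\<rangle>\<close>. However, a certain polynomial \<open>F\<close> of degree two satisfies
  \<open>((1 + x) \<theta>)\<^sup>2 \<langle>F\<rangle> = (1 + 3 x) (1 + x) \<theta> \<langle>F\<rangle> - x\<^sup>2 \<langle>F\<rangle>\<close>, which forces \<open>\<langle>F\<rangle> = 0\<close> because the first two
  coefficients vanish; with this additional relation \<open>A\<close> satisfies an equation of order three. Its
  pullback along \<open>x = v / (1 + 5 v + 8 v\<^sup>2)\<close> is also solved by
  \<open>(1 + 5 v + 8 v\<^sup>2) / (1 + 4 v)\<^sup>2 * (\<Sum>n. u n * t\<^sup>n)\<close> with \<open>t = v / (1 + 4 v)\<^sup>3\<close>. The equation has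
  a unique power series solution with given constant term, so the two power series agree, and the
  identity of functions follows by uniform convergence near \<open>0\<close>.
\<close>

subsection \<open>The recurrence for the two binomial sums\<close>

definition rfact :: "int \<Rightarrow> real" where
  "rfact m = (if m < 0 then 0 else 1 / fact (nat m))"

lemma rfact_of_nat [simp]: "rfact (int n) = 1 / fact n"
  by (simp add: rfact_def)

lemma rfact_neg [simp]: "m < 0 \<Longrightarrow> rfact m = 0"
  by (simp add: rfact_def)

text \<open>At \<open>m = 0\<close> both sides vanish because \<open>1 / (-1)!\<close> is read as
  \<open>0\<close>. The step is thus uniform over all integers, and no range of summation ever needs
  a case distinction.\<close>

lemma rfact_step: "rfact (m - 1) = of_int m * rfact m"
proof -
  consider "m < 0" | "m = 0" | "m > 0" by linarith
  then show ?thesis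
  proof cases
    case 3
    then obtain j where j: "m = int (Suc j)"
      by (metis zero_less_imp_eq_int gr0_implies_Suc)
    have "m - 1 = int j" by (simp add: j)
    then have "rfact (m - 1) = 1 / fact j" by simp
    also have "\<dots> = of_int m * rfact m"
      unfolding j rfact_of_nat by (simp del: of_nat_Suc)
    finally show ?thesis .
  qed auto
qed

text \<open>For \<open>k > n\<close> the last factor is the value \<open>0\<close> at a negative
  argument, in agreement with the vanishing binomial coefficient.\<close>

lemma choose_eq_rfact: "real (n choose k) = fact n * rfact (int k) * rfact (int n - int k)"
proof (cases "k \<le> n")
  case True
  then have "int n - int k = int (n - k)" by simp
  then show ?thesis using True by (simp only: rfact_of_nat) (simp add: binomial_fact)
qed (simp add: binomial_eq_0)

section \<open>The defining sum of \<open>u\<close>: certificate and recurrence\<close>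

definition sq_summand :: "nat \<Rightarrow> nat \<Rightarrow> real" where
  "sq_summand n k = fact (n + k) * fact (2 * k) * rfact (int k)^3 * rfact (int n - int k)^2 * rfact (2 * int k - int n)"

lemma sq_summand_eq: "real ((n choose k)^2 * ((n + k) choose n) * ((2 * k) choose n)) = sq_summand n k"
proof -
  have a: "int (n + k) - int n = int k" by simp
  show ?thesis
    unfolding of_nat_mult of_nat_power choose_eq_rfact sq_summand_def a
    by (simp add: field_simps power2_eq_square power3_eq_cube)
qed

text \<open>Terms with \<open>k > n\<close> are zero, so the three shifts \<open>u n\<close>,
  \<open>u (n + 1)\<close>, \<open>u (n + 2)\<close> can share one summation range and the
  recurrence can be treated termwise.\<close>

lemma u_eq_sum_sq_summand:
  assumes "n \<le> N"
  shows "real_of_int (u n) = (\<Sum>k\<le>N. sq_summand n k)"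
proof -
  have "real_of_int (u n) = (\<Sum>k\<le>n. sq_summand n k)"
    unfolding u_def sq_summand_eq[symmetric] atLeast0AtMost by simp
  also have "\<dots> = (\<Sum>k\<le>N. sq_summand n k)"
    using assms by (intro sum.mono_neutral_left) (auto simp: sq_summand_def)
  finally show ?thesis .
qed

text \<open>
  A common factor of the three shifted summands and of both terms of the certificate: it reduces
  telescoping to a polynomial identity.
\<close>

definition sq_base :: "nat \<Rightarrow> nat \<Rightarrow> real" where
  "sq_base n k = fact (n + k) * fact (2 * k) * rfact (int k)^3 * rfact (int n + 2 - int k)^2 * rfact (2 * int k - int n)"

lemma sq_summand_base:
  fixes n k :: nat
  defines "x \<equiv> real n" and "y \<equiv> real k"
  shows "sq_summand n k = ((x + 2 - y) * (x + 1 - y))^2 * sq_base n k"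
    and "sq_summand (n + 1) k = (x + y + 1) * (x + 2 - y)^2 * (2 * y - x) * sq_base n k"
    and "sq_summand (n + 2) k = (x + y + 1) * (x + y + 2) * (2 * y - x) * (2 * y - x - 1) * sq_base n k"
proof -
  have r1: "rfact (int n + 1 - int k) = (x + 2 - y) * rfact (int n + 2 - int k)"
    using rfact_step[of "int n + 2 - int k"] by (simp add: x_def y_def algebra_simps)
  have r0: "rfact (int n - int k) = (x + 1 - y) * rfact (int n + 1 - int k)"
    using rfact_step[of "int n + 1 - int k"] by (simp add: x_def y_def algebra_simps)
  have q1: "rfact (2 * int k - int n - 1) = (2 * y - x) * rfact (2 * int k - int n)"
    using rfact_step[of "2 * int k - int n"] by (simp add: x_def y_def)
  have q2: "rfact (2 * int k - int n - 2) = (2 * y - x - 1) * rfact (2 * int k - int n - 1)"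
    using rfact_step[of "2 * int k - int n - 1"] by (simp add: x_def y_def)
  show "sq_summand n k = ((x + 2 - y) * (x + 1 - y))^2 * sq_base n k"
    unfolding sq_summand_def sq_base_def r0 r1 by (simp only: power_mult_distrib mult_ac)
  have e1: "int (n + 1) - int k = int n + 1 - int k" "2 * int k - int (n + 1) = 2 * int k - int n - 1" by auto
  have e2: "int (n + 2) - int k = int n + 2 - int k" "2 * int k - int (n + 2) = 2 * int k - int n - 2" by auto
  have f1: "(fact (n + 1 + k) :: real) = (x + y + 1) * fact (n + k)"
    by (simp add: x_def y_def algebra_simps)
  have f2: "(fact (n + 2 + k) :: real) = (x + y + 2) * ((x + y + 1) * fact (n + k))"
    by (simp add: x_def y_def algebra_simps numeral_2_eq_2)
  show "sq_summand (n + 1) k = (x + y + 1) * (x + 2 - y)^2 * (2 * y - x) * sq_base n k"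
    unfolding sq_summand_def sq_base_def e1 f1 r1 q1 by (simp only: power_mult_distrib mult_ac)
  show "sq_summand (n + 2) k = (x + y + 1) * (x + y + 2) * (2 * y - x) * (2 * y - x - 1) * sq_base n k"
    unfolding sq_summand_def sq_base_def e2 f2 q2 q1 by (simp only: power_mult_distrib mult_ac)
qed

text \<open>The ratio of consecutive terms in \<open>k\<close>, cross-multiplied so that it survives
  zeros of the linear factors.\<close>

lemma sq_base_step:
  fixes n k :: nat
  defines "x \<equiv> real n" and "y \<equiv> real k"
  shows "(y + 1)^2 * (2 * y + 2 - x) * (2 * y + 1 - x) * sq_base n (k + 1)
    = 2 * (x + y + 1) * (2 * y + 1) * (x + 2 - y)^2 * sq_base n k"
proof -
  have r1: "rfact (int n + 2 - int (k + 1)) = (x + 2 - y) * rfact (int n + 2 - int k)"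
    using rfact_step[of "int n + 2 - int k"] by (simp add: x_def y_def algebra_simps)
  have q1: "rfact (2 * int k - int n) = (2 * y + 1 - x) * rfact (2 * int k - int n + 1)"
    using rfact_step[of "2 * int k - int n + 1"] by (simp add: x_def y_def algebra_simps)
  have q2: "rfact (2 * int k - int n + 1) = (2 * y + 2 - x) * rfact (2 * int (k + 1) - int n)"
    using rfact_step[of "2 * int k - int n + 2"] by (simp add: x_def y_def algebra_simps)
  have k: "rfact (int k) = (y + 1) * rfact (int (k + 1))"
    using rfact_step[of "int k + 1"] by (simp add: x_def y_def algebra_simps)
  have f: "(fact (n + (k + 1)) :: real) = (x + y + 1) * fact (n + k)"
    "(fact (2 * (k + 1)) :: real) = (2 * (y + 1)) * ((2 * y + 1) * fact (2 * k))"
    by (simp_all add: x_def y_def algebra_simps)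
  show ?thesis
    unfolding sq_base_def f r1 k q1 q2
    by (simp only: power_mult_distrib mult_ac power2_eq_square power3_eq_cube)
qed

text \<open>The claimed recurrence at index \<open>n + 1\<close> with everything on one side; the
  shift keeps the index \<open>-1\<close> out.\<close>

definition rec_defect :: "(nat \<Rightarrow> real) \<Rightarrow> nat \<Rightarrow> real" where
  "rec_defect f n = (real n + 2)^3 * f (n + 2)
     - (2 * real n + 3) * (13 * (real n + 1)^2 + 13 * (real n + 1) + 4) * f (n + 1)
     - 3 * (real n + 1) * (3 * real n + 2) * (3 * real n + 4) * f n"

lemma rec_defect_sum: "rec_defect (\<lambda>n. \<Sum>k\<in>K. f n k) n = (\<Sum>k\<in>K. rec_defect (\<lambda>n. f n k) n)"
  by (simp add: rec_defect_def sum_subtractf sum_distrib_left)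

definition sq_cert_poly :: "real \<Rightarrow> real \<Rightarrow> real" where
  "sq_cert_poly x y = 44 + 72*x + 39*x^2 + 7*x^3 - (78 + 91*x + 26*x^2)*y + (22 + 15*x)*y^2"

text \<open>The telescoping relation with \<open>sq_base n k\<close> divided out, the term at
  \<open>k + 1\<close> having been brought back to \<open>k\<close> by
  \<open>sq_base_step\<close>.\<close>

lemma sq_cert_poly_identity:
  "(x+2)^3 * ((x + y + 1) * (x + y + 2) * (2 * y - x) * (2 * y - x - 1))
   - (2*x+3) * (13*(x+1)^2 + 13*(x+1) + 4) * ((x + y + 1) * (x + 2 - y)^2 * (2 * y - x))
   - 3 * (x+1) * (3*x+2) * (3*x+4) * ((x + 2 - y) * (x + 1 - y))^2
   = sq_cert_poly x (y+1) * (2 * (x + y + 1) * (2 * y + 1) * (x + 2 - y)^2)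
     - sq_cert_poly x y * (y^2 * (2*y - x) * (2*y - x - 1))"
  unfolding sq_cert_poly_def by algebra

text \<open>The factor next to \<open>sq_base n k\<close> is the left-hand factor of
  \<open>sq_base_step\<close> one step earlier, so that lemma rewrites
  \<open>sq_cert n (k + 1)\<close> in terms of \<open>sq_base n k\<close>.\<close>

definition sq_cert :: "nat \<Rightarrow> nat \<Rightarrow> real" where
  "sq_cert n k = (let x = real n; y = real k in
    sq_cert_poly x y * (y^2 * (2*y - x) * (2*y - x - 1) * sq_base n k))"

lemma sq_summand_telescope: "rec_defect (\<lambda>n. sq_summand n k) n = sq_cert n (k + 1) - sq_cert n k"
proof -
  define x y b where d: "x = real n" "y = real k" "b = sq_base n k"
  have "sq_cert n (k + 1) = sq_cert_poly x (y+1) * ((y + 1)^2 * (2 * y + 2 - x) * (2 * y + 1 - x) * sq_base n (k + 1))"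
    by (simp add: sq_cert_def d Let_def algebra_simps)
  also have "(y + 1)^2 * (2 * y + 2 - x) * (2 * y + 1 - x) * sq_base n (k + 1)
    = 2 * (x + y + 1) * (2 * y + 1) * (x + 2 - y)^2 * b"
    unfolding d by (rule sq_base_step)
  finally have g: "sq_cert n (k + 1) = sq_cert_poly x (y+1) * (2 * (x + y + 1) * (2 * y + 1) * (x + 2 - y)^2 * b)" .
  show ?thesis
    using arg_cong[OF sq_cert_poly_identity[of x y], of "\<lambda>t. t * b"]
    unfolding rec_defect_def sq_summand_base[of n k] g unfolding sq_cert_def Let_def d[symmetric]
    by (simp only: left_diff_distrib mult.assoc)
qed

lemma rec_defect_u: "rec_defect (\<lambda>n. real_of_int (u n)) n = 0"
proof -
  have "rec_defect (\<lambda>n. real_of_int (u n)) n = rec_defect (\<lambda>m. \<Sum>k\<le>n+2. sq_summand m k) n"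
    unfolding rec_defect_def by (simp add: u_eq_sum_sq_summand[of _ "n+2"])
  also have "\<dots> = (\<Sum>k<n+3. sq_cert n (k + 1) - sq_cert n k)"
    unfolding rec_defect_sum sq_summand_telescope by (simp add: lessThan_Suc_atMost[symmetric] numeral_3_eq_3 numeral_2_eq_2)
  also have "\<dots> = sq_cert n (n + 3) - sq_cert n 0"
    using sum_lessThan_telescope[of "sq_cert n" "n+3"] by simp
  \<comment> \<open>At \<open>k = 0\<close> the factor \<open>y^2\<close> vanishes; at
    \<open>k = n + 3\<close> the inverse factorial of \<open>n + 2 - k = -1\<close> does.\<close>
  also have "\<dots> = 0" by (simp add: sq_cert_def sq_base_def)
  finally show ?thesis .
qed

section \<open>The alternating sum with cubes: certificate and recurrence\<close>

definition cube_summand :: "nat \<Rightarrow> nat \<Rightarrow> real" where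
  "cube_summand n k = (-1)^(n+k) * fact (3*n+1) * fact (n + k)^3 * rfact (int n - int k)
     * rfact (int (2*n+k+1)) * rfact (int n)^3 * rfact (int k)^3"

definition cube_base :: "nat \<Rightarrow> nat \<Rightarrow> real" where
  "cube_base n k = (-1)^(n+k) * fact (3*n+1) * fact (n + k)^3 * rfact (int n + 2 - int k)
     * rfact (int (2*n+k+5)) * rfact (int (n+2))^3 * rfact (int k)^3"

lemma cube_summand_eq: "(-1)^(n+k) * real ((3 * n + 1) choose (n - k)) * real ((n + k) choose n)^3 = cube_summand n k"
  if "k \<le> n"
proof -
  have "int (3*n+1) - int (n - k) = int (2*n+k+1)" "int (n+k) - int n = int k" "int (n - k) = int n - int k"
    using that by auto
  then show ?thesis
    unfolding choose_eq_rfact cube_summand_def by (simp only: power_mult_distrib mult_ac)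
qed

lemma cube_summand_base:
  fixes n k :: nat
  defines "x \<equiv> real n" and "y \<equiv> real k"
  shows "cube_summand n k = (x+2-y)*(x+1-y)*(2*x+y+2)*(2*x+y+3)*(2*x+y+4)*(2*x+y+5)*((x+1)*(x+2))^3 * cube_base n k"
    and "cube_summand (n + 1) k = - ((3*x+2)*(3*x+3)*(3*x+4)*(x+y+1)^3*(x+2-y)*(2*x+y+4)*(2*x+y+5)*(x+2)^3 * cube_base n k)"
    and "cube_summand (n + 2) k = (3*x+2)*(3*x+3)*(3*x+4)*(3*x+5)*(3*x+6)*(3*x+7)*((x+y+1)*(x+y+2))^3 * cube_base n k"
proof -
  have r1: "rfact (int n + 1 - int k) = (x + 2 - y) * rfact (int n + 2 - int k)"
    using rfact_step[of "int n + 2 - int k"] by (simp add: x_def y_def algebra_simps)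
  have r0: "rfact (int n - int k) = (x + 1 - y) * rfact (int n + 1 - int k)"
    using rfact_step[of "int n + 1 - int k"] by (simp add: x_def y_def algebra_simps)
  have G: "rfact (int n) = (x+1) * rfact (int (n+1))" "rfact (int (n+1)) = (x+2) * rfact (int (n+2))"
    "rfact (int (2*n+k+1)) = (2*x+y+2) * rfact (int (2*n+k+2))"
    "rfact (int (2*n+k+2)) = (2*x+y+3) * rfact (int (2*n+k+3))"
    "rfact (int (2*n+k+3)) = (2*x+y+4) * rfact (int (2*n+k+4))"
    "rfact (int (2*n+k+4)) = (2*x+y+5) * rfact (int (2*n+k+5))"
    using rfact_step[of "int (n+1)"] rfact_step[of "int (n+2)"]
      rfact_step[of "int (2*n+k+2)"] rfact_step[of "int (2*n+k+3)"]
      rfact_step[of "int (2*n+k+4)"] rfact_step[of "int (2*n+k+5)"]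
    by (simp_all add: x_def y_def algebra_simps)
  have F: "(fact (n + k + 1) :: real) = (x+y+1) * fact (n+k)" "(fact (n + k + 2) :: real) = (x+y+2) * fact (n+k+1)"
    "(fact (3*n+2) :: real) = (3*x+2) * fact (3*n+1)"
    "(fact (3*n+3) :: real) = (3*x+3) * fact (3*n+2)"
    "(fact (3*n+4) :: real) = (3*x+4) * fact (3*n+3)"
    "(fact (3*n+5) :: real) = (3*x+5) * fact (3*n+4)"
    "(fact (3*n+6) :: real) = (3*x+6) * fact (3*n+5)"
    "(fact (3*n+7) :: real) = (3*x+7) * fact (3*n+6)"
    by (simp_all add: x_def y_def algebra_simps eval_nat_numeral)
  show "cube_summand n k = (x+2-y)*(x+1-y)*(2*x+y+2)*(2*x+y+3)*(2*x+y+4)*(2*x+y+5)*((x+1)*(x+2))^3 * cube_base n k"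
    unfolding cube_summand_def cube_base_def r0 r1 G by (simp only: power_mult_distrib mult_ac)
  have e1: "int (n + 1) - int k = int n + 1 - int k" "3*(n+1)+1 = 3*n+4" "n+1+k = n+k+1" "2*(n+1)+k+1 = 2*n+k+3"
    "(-1::real)^(n+k+1) = - ((-1)^(n+k))" by auto
  show "cube_summand (n + 1) k = - ((3*x+2)*(3*x+3)*(3*x+4)*(x+y+1)^3*(x+2-y)*(2*x+y+4)*(2*x+y+5)*(x+2)^3 * cube_base n k)"
    unfolding cube_summand_def cube_base_def e1 r1 F G by (simp only: power_mult_distrib mult_minus_left mult_minus_right minus_minus mult_ac)
  have e2: "int (n + 2) - int k = int n + 2 - int k" "3*(n+2)+1 = 3*n+7" "n+2+k = n+k+2" "2*(n+2)+k+1 = 2*n+k+5"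
    "(-1::real)^(n+k+2) = (-1)^(n+k)" by auto
  show "cube_summand (n + 2) k = (3*x+2)*(3*x+3)*(3*x+4)*(3*x+5)*(3*x+6)*(3*x+7)*((x+y+1)*(x+y+2))^3 * cube_base n k"
    unfolding cube_summand_def cube_base_def e2 F by (simp only: power_mult_distrib mult_ac)
qed

lemma cube_base_step:
  fixes n k :: nat
  defines "x \<equiv> real n" and "y \<equiv> real k"
  shows "(y + 1)^3 * (2 * x + y + 6) * cube_base n (k + 1) = - ((x + y + 1)^3 * (x + 2 - y) * cube_base n k)"
proof -
  have r1: "rfact (int n + 2 - int (k + 1)) = (x + 2 - y) * rfact (int n + 2 - int k)"
    using rfact_step[of "int n + 2 - int k"] by (simp add: x_def y_def algebra_simps)
  have G: "rfact (int (2*n+k+5)) = (2*x+y+6) * rfact (int (2*n+(k+1)+5))"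
    "rfact (int k) = (y+1) * rfact (int (k+1))"
    using rfact_step[of "int (2*n+k+6)"] rfact_step[of "int (k+1)"]
    by (simp_all add: x_def y_def algebra_simps)
  have f: "(fact (n + (k + 1)) :: real) = (x + y + 1) * fact (n + k)"
    "(-1::real)^(n+(k+1)) = - ((-1)^(n+k))"
    by (simp_all add: x_def y_def algebra_simps)
  show ?thesis
    unfolding cube_base_def f r1 G by (simp only: power_mult_distrib mult_minus_left mult_minus_right minus_minus mult_ac)
qed

definition cube_cert_poly :: "real \<Rightarrow> real \<Rightarrow> real" where
  "cube_cert_poly x y = 610 + 2273*x + 3320*x^2 + 2376*x^3 + 834*x^4 + 115*x^5
     + (1123 + 3152*x + 3249*x^2 + 1464*x^3 + 244*x^4)*y
     + (668 + 1290*x + 825*x^2 + 175*x^3)*y^2 + (119 + 141*x + 42*x^2)*y^3"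

text \<open>All three shifts share the factor
  \<open>3 * (x+1) * (3*x+2) * (3*x+4) * (x+2)^3\<close>, which is divided out here. The alternating
  sign inside \<open>cube_base\<close> turns the difference of certificates into a sum.\<close>

lemma cube_cert_poly_identity:
  "(3*x+5)*(3*x+6)*(3*x+7)*((x+y+1)*(x+y+2))^3
   + (2*x+3)*(13*(x+1)^2 + 13*(x+1) + 4) * ((x+y+1)^3*(x+2-y)*(2*x+y+4)*(2*x+y+5))
   - (x+2-y)*(x+1-y)*(2*x+y+2)*(2*x+y+3)*(2*x+y+4)*(2*x+y+5)*(x+1)^3
   = cube_cert_poly x (y+1) * ((x + y + 1)^3 * (x + 2 - y)) + cube_cert_poly x y * (y^3 * (2*x + y + 5))"
  unfolding cube_cert_poly_def by algebra

definition cube_cert :: "nat \<Rightarrow> nat \<Rightarrow> real" where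
  "cube_cert n k = (let x = real n; y = real k in
    - (3 * (x+1) * (3*x+2) * (3*x+4) * (x+2)^3) * (cube_cert_poly x y * (y^3 * (2*x + y + 5) * cube_base n k)))"

lemma cube_summand_telescope: "rec_defect (\<lambda>n. cube_summand n k) n = cube_cert n (k + 1) - cube_cert n k"
proof -
  define x y b where d: "x = real n" "y = real k" "b = cube_base n k"
  define c where "c = 3 * (x+1) * (3*x+2) * (3*x+4) * (x+2)^3"
  define A B C where ABC: "A = (3*x+5)*(3*x+6)*(3*x+7)*((x+y+1)*(x+y+2))^3"
    "B = (x+y+1)^3*(x+2-y)*(2*x+y+4)*(2*x+y+5)"
    "C = (x+2-y)*(x+1-y)*(2*x+y+2)*(2*x+y+3)*(2*x+y+4)*(2*x+y+5)*(x+1)^3"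
  have "cube_cert n (k + 1) = - c * (cube_cert_poly x (y+1) * ((y + 1)^3 * (2 * x + y + 6) * cube_base n (k + 1)))"
    by (simp add: cube_cert_def c_def d Let_def algebra_simps)
  also have "(y + 1)^3 * (2 * x + y + 6) * cube_base n (k + 1) = - ((x + y + 1)^3 * (x + 2 - y) * b)"
    unfolding d by (rule cube_base_step)
  finally have g: "cube_cert n (k + 1) = - c * (cube_cert_poly x (y+1) * - ((x + y + 1)^3 * (x + 2 - y) * b))" .
  have e: "3*x+3 = 3*(x+1)" by simp
  have s: "cube_summand n k = C * (x+2)^3 * b" "cube_summand (n+1) k = - (3*(x+1)*(3*x+2)*(3*x+4)*(x+2)^3 * B * b)"
    "cube_summand (n+2) k = 3*(x+1)*(3*x+2)*(3*x+4) * A * b"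
    unfolding cube_summand_base[of n k] ABC d[symmetric] e by (simp_all only: power_mult_distrib mult_ac)
  have comb: "w * (3 * c1 * c2 * c3 * A * b) - D * - (3 * c1 * c2 * c3 * w * B * b) - 3 * c1 * c2 * c3 * (C * w * b)
      = - (3 * c1 * c2 * c3 * w) * (P * - (U * b)) - - (3 * c1 * c2 * c3 * w) * (Q * (V * b))"
    if "A + D * B - C = P * U + Q * V" for w c1 c2 c3 A B C D P Q U V b :: real
    using that by algebra
  show ?thesis
    unfolding g unfolding cube_cert_def Let_def rec_defect_def s d[symmetric] c_def
    using comb[OF cube_cert_poly_identity[of x y, folded ABC]] .
qed

lemma rec_defect_cube: "rec_defect (\<lambda>n. \<Sum>k\<le>n. cube_summand n k) n = 0"
proof -
  have ext: "(\<Sum>k\<le>m. cube_summand m k) = (\<Sum>k\<le>n+2. cube_summand m k)" if "m \<le> n + 2" for m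
    using that by (intro sum.mono_neutral_left) (auto simp: cube_summand_def)
  have "rec_defect (\<lambda>n. \<Sum>k\<le>n. cube_summand n k) n = rec_defect (\<lambda>m. \<Sum>k\<le>n+2. cube_summand m k) n"
    unfolding rec_defect_def using ext[of n] ext[of "n+1"] by simp
  also have "\<dots> = (\<Sum>k<n+3. cube_cert n (k + 1) - cube_cert n k)"
    unfolding rec_defect_sum cube_summand_telescope by (simp add: lessThan_Suc_atMost[symmetric] numeral_3_eq_3 numeral_2_eq_2)
  also have "\<dots> = cube_cert n (n + 3) - cube_cert n 0"
    using sum_lessThan_telescope[of "cube_cert n" "n+3"] by simp
  also have "\<dots> = 0" by (simp add: cube_cert_def cube_base_def)
  finally show ?thesis .
qed

section \<open>Equality of the two sums, and the recurrence over the integers\<close>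

lemma rec_defect_unique:
  assumes f: "\<And>n. rec_defect f n = 0" and g: "\<And>n. rec_defect g n = 0" and "f 0 = g 0" "f 1 = g 1"
  shows "f n = g n"
proof (induction n rule: less_induct)
  case (less n)
  consider "n = 0" | "n = 1" | m where "n = m + 2"
    by (metis One_nat_def add_2_eq_Suc' not0_implies_Suc)
  then show ?case
  proof cases
    case 3
    then have e: "f m = g m" "f (m + 1) = g (m + 1)" using less by auto
    have "(real m + 2)^3 * f (m + 2) = (real m + 2)^3 * g (m + 2)"
      using f[of m] g[of m] unfolding rec_defect_def e by linarith
    moreover have "(real m + 2)^3 \<noteq> 0" by (simp add: add_nonneg_eq_0_iff)
    ultimately show ?thesis unfolding 3 by (metis mult_left_cancel)
  qed (use assms in auto)
qed

text \<open>Both sums have zero defect and the same values \<open>1\<close> and \<open>4\<close> at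
  \<open>n = 0\<close> and \<open>n = 1\<close>.\<close>

lemma u_eq_alternating_sum:
  "u n = (\<Sum>k=0..n. (- 1)^(n - k) * int ((3 * n + 1) choose (n - k)) * int ((n + k) choose n)^3)"
proof -
  have "real_of_int (\<Sum>k=0..n. (- 1)^(n - k) * int ((3 * n + 1) choose (n - k)) * int ((n + k) choose n)^3)
      = (\<Sum>k\<le>n. cube_summand n k)" for n
    unfolding of_int_sum atLeast0AtMost
  proof (intro sum.cong refl)
    fix k assume "k \<in> {..n}"
    then have k: "k \<le> n" by simp
    then have sgn: "(-1::real)^(n - k) = (-1)^(n + k)"
      by (auto simp: minus_one_power_iff)
    show "real_of_int ((- 1)^(n - k) * int ((3 * n + 1) choose (n - k)) * int ((n + k) choose n)^3) = cube_summand n k"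
      unfolding cube_summand_eq[OF k, symmetric] sgn[symmetric] by simp
  qed
  note * = this
  have 0: "real_of_int (u 0) = (\<Sum>k\<le>0. cube_summand 0 k)"
    unfolding *[symmetric] by (simp add: u_def)
  have 1: "real_of_int (u 1) = (\<Sum>k\<le>1. cube_summand 1 k)"
    unfolding *[symmetric] by (simp add: u_def numeral_2_eq_2)
  have "real_of_int (u n) = (\<Sum>k\<le>n. cube_summand n k)"
    by (rule rec_defect_unique[OF rec_defect_u rec_defect_cube 0 1])
  then show ?thesis unfolding *[symmetric] of_int_eq_iff .
qed

lemma u_recurrence:
  "(int n + 1)^3 * u (n + 1) =
          (2 * int n + 1) * (13 * (int n)^2 + 13 * int n + 4) * u n
          + 3 * int n * (3 * int n - 1) * (3 * int n + 1) * (if n = 0 then 0 else u (n - 1))"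
proof (cases n)
  \<comment> \<open>Here \<open>rec_defect\<close> says nothing; the claim is
    \<open>u 1 = 4 * u 0\<close>.\<close>
  case 0
  then show ?thesis by (simp add: u_def numeral_2_eq_2)
next
  case (Suc m)
  have "real_of_int ((int n + 1)^3 * u (n + 1)) =
    real_of_int ((2 * int n + 1) * (13 * (int n)^2 + 13 * int n + 4) * u n
          + 3 * int n * (3 * int n - 1) * (3 * int n + 1) * (if n = 0 then 0 else u (n - 1)))"
    using rec_defect_u[of m] unfolding rec_defect_def Suc by (simp add: algebra_simps)
  then show ?thesis unfolding of_int_eq_iff .
qed

subsection \<open>Formal double sums\<close>

definition theta :: "complex fps \<Rightarrow> complex fps" where
  "theta f = fps_X * fps_deriv f"

lemma theta_nth [simp]: "theta f $ n = of_nat n * f $ n"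
  by (cases n) (simp_all add: theta_def)

lemma theta_add [simp]: "theta (f + g) = theta f + theta g"
  and theta_diff [simp]: "theta (f - g) = theta f - theta g"
  and theta_minus [simp]: "theta (- f) = - theta f"
  and theta_mult [simp]: "theta (f * g) = theta f * g + f * theta g"
  by (simp_all add: theta_def algebra_simps)

lemma theta_one [simp]: "theta 1 = 0"
  and theta_zero [simp]: "theta 0 = 0"
  and theta_of_nat [simp]: "theta (of_nat n) = 0"
  and theta_numeral [simp]: "theta (numeral w) = 0"
  and theta_X [simp]: "theta fps_X = fps_X"
  by (simp_all add: theta_def numeral_fps_const)

lemma theta_X_power [simp]: "theta (fps_X ^ n) = of_nat n * fps_X ^ n"
  by (induction n) (simp_all add: algebra_simps)

definition inv1X :: "complex fps" where "inv1X = inverse (1 + fps_X)"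

lemma inv1X: "(1 + fps_X) * inv1X = 1"
  unfolding inv1X_def by (rule inverse_mult_eq_1') simp

lemma theta_inv1X: "(1 + fps_X) * theta inv1X = - fps_X * inv1X"
proof -
  have "(1 + fps_X) * theta inv1X + fps_X * inv1X = theta ((1 + fps_X) * inv1X)"
    by (simp add: add.commute)
  also have "\<dots> = 0" unfolding inv1X by simp
  finally show ?thesis by (simp add: eq_neg_iff_add_eq_0)
qed

text \<open>Multiplying by \<open>1 + fps_X\<close> keeps the coefficients polynomial; the same
  device is used for all derivatives of the double sums.\<close>

lemma theta_inv1X_power: "(1 + fps_X) * theta (inv1X ^ n) = - of_nat n * fps_X * inv1X ^ n"
proof (induction n)
  case (Suc n)
  have "(1 + fps_X) * theta (inv1X ^ Suc n) = ((1 + fps_X) * theta inv1X) * inv1X ^ n + inv1X * ((1 + fps_X) * theta (inv1X ^ n))"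
    by (simp add: algebra_simps)
  also have "\<dots> = - of_nat (Suc n) * fps_X * inv1X ^ Suc n"
    unfolding theta_inv1X Suc.IH by (simp add: algebra_simps)
  finally show ?case .
qed simp

text \<open>Cutting off at \<open>n, k \<le> m\<close> in the \<open>m\<close>-th coefficient loses nothing for bigraded families.\<close>

definition dsum :: "(nat \<Rightarrow> nat \<Rightarrow> complex fps) \<Rightarrow> complex fps" where
  "dsum \<Psi> = Abs_fps (\<lambda>m. \<Sum>n\<le>m. \<Sum>k\<le>m. \<Psi> n k $ m)"

definition bigraded :: "(nat \<Rightarrow> nat \<Rightarrow> complex fps) \<Rightarrow> bool" where
  "bigraded \<Psi> \<longleftrightarrow> (\<forall>n k m. m < n + k \<longrightarrow> \<Psi> n k $ m = 0)"

lemma dsum_nth: "dsum \<Psi> $ m = (\<Sum>n\<le>m. \<Sum>k\<le>m. \<Psi> n k $ m)"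
  by (simp add: dsum_def)

lemma dsum_nth_le:
  assumes "bigraded \<Psi>" "m \<le> N"
  shows "dsum \<Psi> $ m = (\<Sum>n\<le>N. \<Sum>k\<le>N. \<Psi> n k $ m)"
proof -
  have "dsum \<Psi> $ m = (\<Sum>n\<le>m. \<Sum>k\<le>N. \<Psi> n k $ m)"
    unfolding dsum_nth using assms
    by (intro sum.cong refl sum.mono_neutral_left) (auto simp: bigraded_def)
  also have "\<dots> = (\<Sum>n\<le>N. \<Sum>k\<le>N. \<Psi> n k $ m)"
    using assms by (intro sum.mono_neutral_left) (auto simp: bigraded_def)
  finally show ?thesis .
qed

lemma dsum_add: "dsum (\<lambda>n k. \<Phi> n k + \<Psi> n k) = dsum \<Phi> + dsum \<Psi>"
  by (rule fps_ext) (simp add: dsum_nth sum.distrib)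

lemma dsum_diff: "dsum (\<lambda>n k. \<Phi> n k - \<Psi> n k) = dsum \<Phi> - dsum \<Psi>"
  by (rule fps_ext) (simp add: dsum_nth sum_subtractf)

lemma bigraded_mult: "bigraded \<Psi> \<Longrightarrow> bigraded (\<lambda>n k. P n k * \<Psi> n k)"
  unfolding bigraded_def by (auto simp: fps_mult_nth intro!: sum.neutral)

text \<open>A product mixes coefficients of several degrees, each with its own cutoff; the grading
  lets all of them be raised to the common cutoff \<open>m\<close>.\<close>

lemma dsum_mult:
  assumes "bigraded \<Psi>"
  shows "dsum (\<lambda>n k. P * \<Psi> n k) = P * dsum \<Psi>"
proof (rule fps_ext)
  fix m
  have "(P * dsum \<Psi>) $ m = (\<Sum>i=0..m. P $ i * (\<Sum>n\<le>m. \<Sum>k\<le>m. \<Psi> n k $ (m - i)))"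
    unfolding fps_mult_nth using assms by (intro sum.cong refl) (simp add: dsum_nth_le)
  also have "\<dots> = (\<Sum>n\<le>m. \<Sum>k\<le>m. \<Sum>i=0..m. P $ i * \<Psi> n k $ (m - i))"
    unfolding sum_distrib_left
    by (simp only: sum.swap[of _ _ "{0..m}"])
  also have "\<dots> = dsum (\<lambda>n k. P * \<Psi> n k) $ m"
    by (simp add: dsum_nth fps_mult_nth)
  finally show "dsum (\<lambda>n k. P * \<Psi> n k) $ m = (P * dsum \<Psi>) $ m" ..
qed

lemma theta_dsum: "theta (dsum \<Psi>) = dsum (\<lambda>n k. theta (\<Psi> n k))"
  by (rule fps_ext) (simp add: dsum_nth sum_distrib_left)

text \<open>Reindexing drops \<open>k = 0\<close>, which is zero by assumption, and adds
  \<open>k = m + 1\<close>, which is zero in degree \<open>m\<close> by the grading.\<close>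

lemma dsum_shift_right:
  assumes "bigraded \<Psi>" "\<And>n. \<Psi> n 0 = 0"
  shows "dsum (\<lambda>n k. \<Psi> n (k + 1)) = dsum \<Psi>"
proof (rule fps_ext)
  fix m
  have "(\<Sum>k\<le>m. \<Psi> n (k + 1) $ m) = (\<Sum>k\<le>m. \<Psi> n k $ m)" for n
  proof -
    have "(\<Sum>k\<le>Suc m. \<Psi> n k $ m) = (\<Sum>k\<le>m. \<Psi> n (k + 1) $ m)"
      unfolding sum.atMost_Suc_shift assms(2) by simp
    moreover have "\<Psi> n (Suc m) $ m = 0" using assms(1) by (simp add: bigraded_def)
    ultimately show ?thesis by simp
  qed
  then show "dsum (\<lambda>n k. \<Psi> n (k + 1)) $ m = dsum \<Psi> $ m"
    by (simp add: dsum_nth)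
qed

lemma dsum_swap: "dsum (\<lambda>n k. \<Psi> k n) = dsum \<Psi>"
  by (rule fps_ext) (simp add: dsum_nth sum.swap[of "\<lambda>n k. \<Psi> n k $ _"])

lemma dsum_shift_left:
  assumes "bigraded \<Psi>" "\<And>k. \<Psi> 0 k = 0"
  shows "dsum (\<lambda>n k. \<Psi> (n + 1) k) = dsum \<Psi>"
proof -
  have "bigraded (\<lambda>n k. \<Psi> k n)" using assms(1) by (auto simp: bigraded_def add.commute)
  then have "dsum (\<lambda>n k. \<Psi> (k + 1) n) = dsum (\<lambda>n k. \<Psi> k n)"
    using dsum_shift_right[of "\<lambda>n k. \<Psi> k n"] assms(2) by simp
  then show ?thesis
    using dsum_swap[of \<Psi>] dsum_swap[of "\<lambda>n k. \<Psi> (n + 1) k"] by simp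
qed

section \<open>The hypergeometric coefficients of the left-hand side\<close>

definition lcoef :: "nat \<Rightarrow> nat \<Rightarrow> nat" where
  "lcoef n k = ((2 * n) choose n) * ((n choose k) * ((n + k) choose n) * ((2 * k) choose k))"

lemma central_binomial_step: "(n + 1) * ((2 * (n + 1)) choose (n + 1)) = 2 * (2 * n + 1) * ((2 * n) choose n)"
proof -
  have c: "real ((2 * m) choose m) = fact (2 * m) / fact m ^ 2" for m
    using binomial_fact[of m "2 * m", where 'a=real] by (simp add: power2_eq_square)
  have f: "(fact (2 * (n + 1)) :: real) = 2 * (real n + 1) * ((2 * real n + 1) * fact (2 * n))"
    "(fact (n + 1) :: real) = (real n + 1) * fact n"
    by (simp_all add: algebra_simps)
  have nz: "real n + 1 \<noteq> 0" by (simp add: add_nonneg_eq_0_iff)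
  have "real ((n + 1) * ((2 * (n + 1)) choose (n + 1))) = real (2 * (2 * n + 1) * ((2 * n) choose n))"
  proof -
    have "(r + 1) * (2 * (r + 1) * ((2 * r + 1) * F) / ((r + 1) * f)^2) = 2 * (2 * r + 1) * (F / f^2)"
      if "r + 1 \<noteq> 0" "f \<noteq> 0" for r f F :: real
      using that by (simp add: divide_simps) algebra
    from this[OF nz, of "fact n" "fact (2 * n)"] show ?thesis
      unfolding of_nat_mult c f by (simp add: add.commute)
  qed
  then show ?thesis by (simp only: of_nat_eq_iff)
qed

text \<open>The right-hand side depends on \<open>n\<close> through a single binomial coefficient,
  so that the step from \<open>n\<close> to \<open>n + 1\<close> costs one linear factor on each
  side.\<close>

lemma binomial_product: "(n choose k) * ((n + k) choose n) = ((n + k) choose (2 * k)) * ((2 * k) choose k)"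
proof (cases "k \<le> n")
  case True
  then show ?thesis
    using choose_mult[of k "2*k" "n+k"] binomial_symmetric[of n "n+k"]
    by (simp add: mult.commute)
qed (simp add: binomial_eq_0)

text \<open>Each of the three binomials involving \<open>k\<close> absorbs one factor
  \<open>k + 1\<close>. The subtraction takes place in a ring, so the right side vanishes correctly
  at \<open>k = n\<close>.\<close>

lemma lcoef_step_k:
  "(of_nat k + 1)^3 * of_nat (lcoef n (k + 1))
    = 2 * (2 * of_nat k + 1) * (of_nat n - of_nat k) * (of_nat n + of_nat k + 1) * (of_nat (lcoef n k) :: 'a :: comm_ring_1)"
proof -
  let ?o = "of_nat :: nat \<Rightarrow> 'a"
  have a: "(?o k + 1) * ?o (n choose (k + 1)) = (?o n - ?o k) * ?o (n choose k)"
  proof (cases "k \<le> n")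
    case True
    have "(k + 1) * (n choose (k + 1)) = (n - k) * (n choose k)"
      using binomial_absorb_comp[of n k] binomial_absorption[of k n] by simp
    then have "?o ((k + 1) * (n choose (k + 1))) = ?o ((n - k) * (n choose k))" by simp
    then show ?thesis using True by (simp add: of_nat_diff algebra_simps)
  qed (simp add: binomial_eq_0)
  have b: "(?o k + 1) * ?o ((n + (k + 1)) choose n) = (?o n + ?o k + 1) * ?o ((n + k) choose n)"
  proof -
    have "(k + 1) * ((n + (k + 1)) choose n) = (n + k + 1) * ((n + k) choose n)"
      using Suc_times_binomial_eq[of "n+k" k] binomial_symmetric[of n "n+k"] binomial_symmetric[of n "n+(k+1)"]
      by (simp add: mult.commute)
    then have "?o ((k + 1) * ((n + (k + 1)) choose n)) = ?o ((n + k + 1) * ((n + k) choose n))" by simp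
    then show ?thesis by (simp add: algebra_simps)
  qed
  have c: "(?o k + 1) * ?o ((2 * (k + 1)) choose (k + 1)) = 2 * (2 * ?o k + 1) * ?o ((2 * k) choose k)"
    using arg_cong[OF central_binomial_step[of k], of ?o] by (simp only: of_nat_mult of_nat_add of_nat_1 of_nat_numeral)
  have "(?o k + 1)^3 * ?o (lcoef n (k + 1)) = ?o ((2 * n) choose n) * ((?o k + 1) * ?o (n choose (k + 1)))
     * ((?o k + 1) * ?o ((n + (k + 1)) choose n)) * ((?o k + 1) * ?o ((2 * (k + 1)) choose (k + 1)))"
    unfolding lcoef_def of_nat_mult by (simp only: power3_eq_cube mult_ac)
  also have "\<dots> = 2 * (2 * ?o k + 1) * (?o n - ?o k) * (?o n + ?o k + 1) * ?o (lcoef n k)"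
    unfolding a b c unfolding lcoef_def of_nat_mult by (simp only: mult_ac)
  finally show ?thesis .
qed

lemma lcoef_step_n:
  "(of_nat n + 1) * (of_nat n + 1 - of_nat k) * of_nat (lcoef (n + 1) k)
    = 2 * (2 * of_nat n + 1) * (of_nat n + of_nat k + 1) * (of_nat (lcoef n k) :: 'a :: comm_ring_1)"
proof -
  let ?o = "of_nat :: nat \<Rightarrow> 'a"
  have a: "(?o n + 1 - ?o k) * ?o ((n + 1 + k) choose (2 * k)) = (?o n + ?o k + 1) * ?o ((n + k) choose (2 * k))"
  proof (cases "k \<le> n")
    case True
    then have "n + k + 1 - 2 * k = n + 1 - k" by simp
    then have "(n + 1 - k) * ((n + 1 + k) choose (2 * k)) = (n + k + 1) * ((n + k) choose (2 * k))"
      using binomial_absorb_comp[of "n+k+1" "2*k"] by (simp add: ac_simps)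
    then have "?o ((n + 1 - k) * ((n + 1 + k) choose (2 * k))) = ?o ((n + k + 1) * ((n + k) choose (2 * k)))" by simp
    moreover have "?o (n + 1 - k) = ?o n + 1 - ?o k"
      using True by (simp add: of_nat_diff)
    ultimately show ?thesis by (simp only: of_nat_mult of_nat_add of_nat_1)
  next
    case False
    \<comment> \<open>At \<open>k = n + 1\<close> the left side is killed by its linear factor,
      beyond that by its binomial; the binomial on the right is zero in both cases.\<close>
    then consider "k = n + 1" | "k > n + 1" by linarith
    then show ?thesis by cases (simp_all add: binomial_eq_0)
  qed
  have c: "(?o n + 1) * ?o ((2 * (n + 1)) choose (n + 1)) = 2 * (2 * ?o n + 1) * ?o ((2 * n) choose n)"
    using arg_cong[OF central_binomial_step[of n], of ?o] by (simp only: of_nat_mult of_nat_add of_nat_1 of_nat_numeral)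
  have "(?o n + 1) * (?o n + 1 - ?o k) * ?o (lcoef (n + 1) k)
     = ((?o n + 1) * ?o ((2 * (n + 1)) choose (n + 1))) * ((?o n + 1 - ?o k) * ?o ((n + 1 + k) choose (2 * k)))
       * ?o ((2 * k) choose k)^2"
    unfolding lcoef_def binomial_product of_nat_mult by (simp only: power2_eq_square mult_ac)
  also have "\<dots> = 2 * (2 * ?o n + 1) * (?o n + ?o k + 1) * ?o (lcoef n k)"
    unfolding a c unfolding lcoef_def binomial_product of_nat_mult by (simp only: power2_eq_square mult_ac)
  finally show ?thesis .
qed

text \<open>With \<open>z = x / (1 + x)^2\<close> the monomial \<open>x^k * z^n\<close> has
  denominator \<open>(1 + x)^(2 * n)\<close>. One more factor \<open>1 / (1 + x)\<close> is
  included, so the resulting series is the left-hand side divided by \<open>1 + x\<close>.\<close>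

definition lmon :: "nat \<Rightarrow> nat \<Rightarrow> complex fps" where
  "lmon n k = of_nat (lcoef n k) * fps_X ^ (n + k) * inv1X ^ (2 * n + 1)"

lemma bigraded_lmon: "bigraded lmon"
proof -
  have "lmon n k = fps_X ^ (n + k) * (of_nat (lcoef n k) * inv1X ^ (2 * n + 1))" for n k
    unfolding lmon_def by (simp only: mult_ac)
  then show ?thesis by (simp add: bigraded_def fps_X_power_mult_nth)
qed

text \<open>The logarithmic derivative of the monomial is
  \<open>n + k - (2 * n + 1) * x / (1 + x)\<close>.\<close>

lemma theta_lmon:
  "(1 + fps_X) * theta (lmon n k) = ((1 + fps_X) * of_nat k + of_nat n * (1 - fps_X) - fps_X) * lmon n k"
proof -
  have "(1 + fps_X) * theta (lmon n k) = of_nat (n + k) * (1 + fps_X) * lmon n k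
      + of_nat (lcoef n k) * fps_X ^ (n + k) * ((1 + fps_X) * theta (inv1X ^ (2 * n + 1)))"
    unfolding lmon_def theta_mult theta_X_power theta_of_nat by algebra
  also have "\<dots> = ((1 + fps_X) * of_nat k + of_nat n * (1 - fps_X) - fps_X) * lmon n k"
    unfolding theta_inv1X_power lmon_def of_nat_add of_nat_mult of_nat_numeral of_nat_1 by algebra
  finally show ?thesis .
qed

section \<open>Weighted double sums and their linear relations\<close>

definition lsum :: "(nat \<Rightarrow> nat \<Rightarrow> complex fps) \<Rightarrow> complex fps" where
  "lsum \<Phi> = dsum (\<lambda>n k. \<Phi> n k * lmon n k)"

lemma lsum_add: "lsum (\<lambda>n k. \<Phi> n k + \<Psi> n k) = lsum \<Phi> + lsum \<Psi>"
  by (simp add: lsum_def dsum_add algebra_simps)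

lemma lsum_diff: "lsum (\<lambda>n k. \<Phi> n k - \<Psi> n k) = lsum \<Phi> - lsum \<Psi>"
  by (simp add: lsum_def dsum_diff algebra_simps)

lemma lsum_mult: "lsum (\<lambda>n k. P * \<Phi> n k) = P * lsum \<Phi>"
  unfolding lsum_def mult.assoc by (intro dsum_mult bigraded_mult bigraded_lmon)

lemma theta_lsum:
  "(1 + fps_X) * theta (lsum \<Phi>) = lsum (\<lambda>n k. (1 + fps_X) * theta (\<Phi> n k)
      + \<Phi> n k * ((1 + fps_X) * of_nat k + of_nat n * (1 - fps_X) - fps_X))"
proof -
  have "bigraded (\<lambda>n k. theta (\<Phi> n k * lmon n k))"
    using bigraded_mult[OF bigraded_lmon, of \<Phi>] by (auto simp: bigraded_def simp del: theta_mult)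
  then have "(1 + fps_X) * theta (lsum \<Phi>) = dsum (\<lambda>n k. (1 + fps_X) * theta (\<Phi> n k * lmon n k))"
    unfolding lsum_def theta_dsum by (rule dsum_mult [symmetric])
  also have "(\<lambda>n k. (1 + fps_X) * theta (\<Phi> n k * lmon n k)) = (\<lambda>n k. ((1 + fps_X) * theta (\<Phi> n k)
      + \<Phi> n k * ((1 + fps_X) * of_nat k + of_nat n * (1 - fps_X) - fps_X)) * lmon n k)"
  proof (intro ext)
    fix n k
    have "(1 + fps_X) * theta (\<Phi> n k * lmon n k) = (1 + fps_X) * theta (\<Phi> n k) * lmon n k + \<Phi> n k * ((1 + fps_X) * theta (lmon n k))"
      by (simp add: algebra_simps)
    then show "(1 + fps_X) * theta (\<Phi> n k * lmon n k) = ((1 + fps_X) * theta (\<Phi> n k)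
      + \<Phi> n k * ((1 + fps_X) * of_nat k + of_nat n * (1 - fps_X) - fps_X)) * lmon n k"
      unfolding theta_lmon by (simp only: distrib_right mult.assoc)
  qed
  finally show ?thesis unfolding lsum_def .
qed

text \<open>Reindex \<open>k\<close> in the sum weighted by \<open>Q n k * k^3\<close>: the cube
  kills the boundary term \<open>k = 0\<close> and is exactly what \<open>lcoef_step_k\<close>
  absorbs.\<close>

lemma lsum_relation_k:
  "lsum (\<lambda>n k. Q n k * of_nat k ^ 3
     - 2 * fps_X * Q n (k + 1) * (2 * of_nat k + 1) * (of_nat n - of_nat k) * (of_nat n + of_nat k + 1)) = 0"
proof -
  define \<Psi> where "\<Psi> = (\<lambda>n k. (Q n k * of_nat k ^ 3) * lmon n k)"
  have step: "of_nat (k + 1) ^ 3 * lmon n (k + 1)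
      = 2 * fps_X * (2 * of_nat k + 1) * (of_nat n - of_nat k) * (of_nat n + of_nat k + 1) * lmon n k" for n k
  proof -
    have "of_nat (k + 1) ^ 3 * lmon n (k + 1) = fps_X * ((of_nat k + 1)^3 * of_nat (lcoef n (k + 1))) * fps_X ^ (n + k) * inv1X ^ (2 * n + 1)"
      unfolding lmon_def by (simp add: algebra_simps)
    also have "\<dots> = 2 * fps_X * (2 * of_nat k + 1) * (of_nat n - of_nat k) * (of_nat n + of_nat k + 1) * lmon n k"
      unfolding lcoef_step_k lmon_def by (simp only: mult_ac)
    finally show ?thesis .
  qed
  have "dsum (\<lambda>n k. \<Psi> n (k + 1)) = dsum \<Psi>"
    by (rule dsum_shift_right) (auto simp: \<Psi>_def intro: bigraded_mult bigraded_lmon)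
  moreover have "\<Psi> n (k + 1) = 2 * fps_X * Q n (k + 1) * (2 * of_nat k + 1) * (of_nat n - of_nat k) * (of_nat n + of_nat k + 1) * lmon n k" for n k
  proof -
    have "\<Psi> n (k + 1) = Q n (k + 1) * (of_nat (k + 1) ^ 3 * lmon n (k + 1))"
      unfolding \<Psi>_def by (simp only: mult_ac)
    then show ?thesis unfolding step by (simp only: mult_ac)
  qed
  ultimately show ?thesis
    unfolding lsum_diff unfolding lsum_def \<Psi>_def by (simp only: right_minus_eq)
qed

text \<open>The same with \<open>n\<close>: the factor \<open>n\<close> kills the boundary, and
  \<open>(1 + fps_X)^2\<close> clears the denominator of the extra factor \<open>z\<close>.\<close>

lemma lsum_relation_n:
  "lsum (\<lambda>n k. (1 + fps_X)^2 * Q n k * of_nat n * (of_nat n - of_nat k)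
     - 2 * fps_X * Q (n + 1) k * (2 * of_nat n + 1) * (of_nat n + of_nat k + 1)) = 0"
proof -
  define \<Psi> where "\<Psi> = (\<lambda>n k. ((1 + fps_X)^2 * Q n k * of_nat n * (of_nat n - of_nat k)) * lmon n k)"
  have step: "(1 + fps_X)^2 * of_nat (n + 1) * (of_nat (n + 1) - of_nat k) * lmon (n + 1) k
      = 2 * fps_X * (2 * of_nat n + 1) * (of_nat n + of_nat k + 1) * lmon n k" for n k
  proof -
    have "(1 + fps_X)^2 * of_nat (n + 1) * (of_nat (n + 1) - of_nat k) * lmon (n + 1) k
      = ((1 + fps_X) * inv1X)^2 * fps_X * ((of_nat n + 1) * (of_nat n + 1 - of_nat k) * of_nat (lcoef (n + 1) k)) * fps_X ^ (n + k) * inv1X ^ (2 * n + 1)"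
    proof -
      have "inv1X ^ (2 * (n + 1) + 1) = inv1X^2 * inv1X ^ (2 * n + 1)" "(fps_X :: complex fps) ^ (n + 1 + k) = fps_X * fps_X ^ (n + k)"
        by (simp_all add: power2_eq_square mult_ac)
      then show ?thesis
        unfolding lmon_def power_mult_distrib by (simp only: of_nat_add of_nat_1 mult_ac)
    qed
    also have "\<dots> = 2 * fps_X * (2 * of_nat n + 1) * (of_nat n + of_nat k + 1) * lmon n k"
      unfolding lcoef_step_n lmon_def inv1X by (simp only: mult_ac power_one mult_1_left mult_1_right)
    finally show ?thesis .
  qed
  have "dsum (\<lambda>n k. \<Psi> (n + 1) k) = dsum \<Psi>"
    by (rule dsum_shift_left) (auto simp: \<Psi>_def intro: bigraded_mult bigraded_lmon)
  moreover have "\<Psi> (n + 1) k = 2 * fps_X * Q (n + 1) k * (2 * of_nat n + 1) * (of_nat n + of_nat k + 1) * lmon n k" for n k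
  proof -
    have "\<Psi> (n + 1) k = Q (n + 1) k * ((1 + fps_X)^2 * of_nat (n + 1) * (of_nat (n + 1) - of_nat k) * lmon (n + 1) k)"
      unfolding \<Psi>_def by (simp only: mult_ac)
    then show ?thesis unfolding step by (simp only: mult_ac)
  qed
  ultimately show ?thesis
    unfolding lsum_diff unfolding lsum_def \<Psi>_def by (simp only: right_minus_eq)
qed

subsection \<open>The differential equation in \<open>x\<close>\<close>

lemma theta_power [simp]: "theta (f ^ n) = of_nat n * f ^ (n - 1) * theta f"
proof (induction n)
  case (Suc n)
  then show ?case by (cases n) (simp_all add: algebra_simps)
qed simp

text \<open>
  The symbols \<open>lsym\<close>, \<open>theta2_sym\<close>, \<open>theta3_sym\<close> represent \<open>(1 + x)\<^sup>j \<theta>\<^sup>j A\<close>, and \<open>ker0\<close>, \<open>ker1\<close>, \<open>ker2\<close>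
  represent \<open>((1 + x) \<theta>)\<^sup>j \<langle>F\<rangle>\<close>; the prefix \<open>d\<close> stands for \<open>x \<partial>/\<partial>x\<close>.
\<close>

definition lsym :: "'a::idom \<Rightarrow> 'a \<Rightarrow> 'a \<Rightarrow> 'a" where
  "lsym x n k = (1 + x) * k + n * (1 - x) - x"

definition dlsym :: "'a::idom \<Rightarrow> 'a \<Rightarrow> 'a \<Rightarrow> 'a" where
  "dlsym x n k = x * (k - n - 1)"

definition theta2_sym :: "'a::idom \<Rightarrow> 'a \<Rightarrow> 'a \<Rightarrow> 'a" where
  "theta2_sym x n k = (1 + x) * dlsym x n k + lsym x n k * lsym x n k - x * lsym x n k"

definition dtheta2_sym :: "'a::idom \<Rightarrow> 'a \<Rightarrow> 'a \<Rightarrow> 'a" where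
  "dtheta2_sym x n k = (x + 2*x^2) * (k - n - 1) + 2 * lsym x n k * dlsym x n k - x * lsym x n k - x * dlsym x n k"

definition theta3_sym :: "'a::idom \<Rightarrow> 'a \<Rightarrow> 'a \<Rightarrow> 'a" where
  "theta3_sym x n k = (1 + x) * dtheta2_sym x n k + theta2_sym x n k * lsym x n k - 2 * x * theta2_sym x n k"

definition ker0 :: "'a::idom \<Rightarrow> 'a \<Rightarrow> 'a \<Rightarrow> 'a" where
  "ker0 x n k = 2*(1 + 6*x + 9*x^2 + 4*x^3)*k^2 - (1 + 6*x + 17*x^2 + 8*x^3)*n*k
     - 4*(x + 2*x^2 + x^3)*n + 2*(3*x + 4*x^2 + 2*x^3)*k"

definition dker0 :: "'a::idom \<Rightarrow> 'a \<Rightarrow> 'a \<Rightarrow> 'a" where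
  "dker0 x n k = 2*(6*x + 18*x^2 + 12*x^3)*k^2 - (6*x + 34*x^2 + 24*x^3)*n*k
     - 4*(x + 4*x^2 + 3*x^3)*n + 2*(3*x + 8*x^2 + 6*x^3)*k"

definition ddker0 :: "'a::idom \<Rightarrow> 'a \<Rightarrow> 'a \<Rightarrow> 'a" where
  "ddker0 x n k = 2*(6*x + 36*x^2 + 36*x^3)*k^2 - (6*x + 68*x^2 + 72*x^3)*n*k
     - 4*(x + 8*x^2 + 9*x^3)*n + 2*(3*x + 16*x^2 + 18*x^3)*k"

definition ker1 :: "'a::idom \<Rightarrow> 'a \<Rightarrow> 'a \<Rightarrow> 'a" where
  "ker1 x n k = (1 + x) * dker0 x n k + ker0 x n k * lsym x n k"

definition dker1 :: "'a::idom \<Rightarrow> 'a \<Rightarrow> 'a \<Rightarrow> 'a" where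
  "dker1 x n k = x * dker0 x n k + (1 + x) * ddker0 x n k + dker0 x n k * lsym x n k + ker0 x n k * dlsym x n k"

definition ker2 :: "'a::idom \<Rightarrow> 'a \<Rightarrow> 'a \<Rightarrow> 'a" where
  "ker2 x n k = (1 + x) * dker1 x n k + ker1 x n k * lsym x n k"

text \<open>Symbols that sum to zero for every multiplier \<open>Q\<close>, by
  \<open>lsum_relation_k\<close>; \<open>rel_n\<close> plays the same role for
  \<open>lsum_relation_n\<close>.\<close>

definition rel_k :: "('a::idom \<Rightarrow> 'a \<Rightarrow> 'a \<Rightarrow> 'a) \<Rightarrow> 'a \<Rightarrow> 'a \<Rightarrow> 'a \<Rightarrow> 'a" where
  "rel_k Q x n k = Q x n k * k^3 - 2 * x * Q x n (k + 1) * (2 * k + 1) * (n - k) * (n + k + 1)"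

definition rel_n :: "('a::idom \<Rightarrow> 'a \<Rightarrow> 'a \<Rightarrow> 'a) \<Rightarrow> 'a \<Rightarrow> 'a \<Rightarrow> 'a \<Rightarrow> 'a" where
  "rel_n Q x n k = (1 + x)^2 * Q x n k * n * (n - k) - 2 * x * Q x (n + 1) k * (2 * n + 1) * (n + k + 1)"

definition ker_mult_k :: "'a::idom \<Rightarrow> 'a \<Rightarrow> 'a \<Rightarrow> 'a" where
  "ker_mult_k x n k = (-2 - 6*x - 6*x^2 + 6*x^3) + (2 + 4*x + 2*x^2)*(1 + x)^2*k + (2 - 8*x^2 + 8*x^3 - 2*x^4)*n"

definition ker_mult_n :: "'a::idom \<Rightarrow> 'a \<Rightarrow> 'a \<Rightarrow> 'a" where
  "ker_mult_n x n k = 8*x^3 + (1 + x + 24*x^3)*k - 8*x^3*n + (-1 - 2*x + 3*x^2 + 16*x^3)*k^2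
     + (-1 + 2*x - x^2 - 16*x^3)*n*k"

text \<open>A polynomial identity in \<open>x\<close>, \<open>n\<close>, \<open>k\<close>. Its right
  side sums to zero, which gives the second-order equation for
  \<open>poly_lsum ker0\<close>.\<close>

lemma kernel_certificate:
  "ker2 x n k - (1 + 3*x) * ker1 x n k + x^2 * ker0 x n k = rel_k ker_mult_k x n k + rel_n ker_mult_n x n k"
  for x :: "'a::idom"
  unfolding ker2_def ker1_def ker0_def dker0_def ddker0_def rel_k_def rel_n_def ker_mult_k_def ker_mult_n_def lsym_def dlsym_def dker1_def
  by algebra

definition ode_mult_k :: "'a::idom \<Rightarrow> 'a \<Rightarrow> 'a \<Rightarrow> 'a" where
  "ode_mult_k x n k = 2*(1 + x)^3*(7 + 14*x - 21*x^2)"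

definition ode_mult_n :: "'a::idom \<Rightarrow> 'a \<Rightarrow> 'a \<Rightarrow> 'a" where
  "ode_mult_n x n k = 2*x*(22*x + 2*x^2 - 36*x^3 - 28*x^4) + (1 + x)*(-7 + 9*x + 107*x^2 + 11*x^3 - 56*x^4)*k
     + 2*x*(1 - 7*x - 41*x^2 + 19*x^3 + 28*x^4)*n"

text \<open>Every term on the right sums to zero once \<open>poly_lsum ker0 = 0\<close> is known.
  What remains on the left is \<open>2 * x\<close> times the third-order equation, in
  symbols.\<close>

lemma ode_certificate:
  "2 * x * ((1 - 6*x - 47*x^2 - 28*x^3) * theta3_sym x n k
    - (1 + x) * (9*x + 141*x^2 + 126*x^3) * theta2_sym x n k
    - (1 + x)^2 * (5*x + 145*x^2 + 182*x^3) * lsym x n k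
    - (1 + x)^3 * (x + 51*x^2 + 84*x^3))
   = x * (7 + 17*x - 31*x^2 + 7*x^3) * ker0 x n k
     + (-7 - 13*x + 11*x^2 - 7*x^3) * ker1 x n k + rel_k ode_mult_k x n k + rel_n ode_mult_n x n k"
  for x :: "'a::idom"
  unfolding theta3_sym_def theta2_sym_def ker1_def ker0_def dker0_def rel_k_def rel_n_def ode_mult_k_def ode_mult_n_def lsym_def dlsym_def dtheta2_sym_def
  by algebra

abbreviation poly_lsum :: "(complex fps \<Rightarrow> complex fps \<Rightarrow> complex fps \<Rightarrow> complex fps) \<Rightarrow> complex fps" where
  "poly_lsum p \<equiv> lsum (\<lambda>n k. p fps_X (of_nat n) (of_nat k))"

lemma poly_lsum_rel_k: "poly_lsum (rel_k Q) = 0"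
  using lsum_relation_k[of "\<lambda>n k. Q fps_X (of_nat n) (of_nat k)"]
  by (simp add: rel_k_def add.commute)

lemma poly_lsum_rel_n: "poly_lsum (rel_n Q) = 0"
  using lsum_relation_n[of "\<lambda>n k. Q fps_X (of_nat n) (of_nat k)"]
  by (simp add: rel_n_def add.commute)

lemma theta_poly_lsum:
  assumes "\<And>n k. theta (p fps_X (of_nat n) (of_nat k)) = dp fps_X (of_nat n) (of_nat k)"
  shows "(1 + fps_X) * theta (poly_lsum p) = poly_lsum (\<lambda>x n k. (1 + x) * dp x n k + p x n k * lsym x n k)"
  unfolding theta_lsum assms lsym_def ..

lemma theta_ker0: "theta (ker0 fps_X (of_nat n) (of_nat k)) = dker0 fps_X (of_nat n) (of_nat k)"
  unfolding ker0_def dker0_def by simp algebra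

lemma theta_dker0: "theta (dker0 fps_X (of_nat n) (of_nat k)) = ddker0 fps_X (of_nat n) (of_nat k)"
  unfolding ddker0_def dker0_def by simp algebra

lemma theta_lsym: "theta (lsym fps_X (of_nat n) (of_nat k)) = dlsym fps_X (of_nat n) (of_nat k)"
  unfolding lsym_def dlsym_def by simp algebra

lemma theta_ker1: "theta (ker1 fps_X (of_nat n) (of_nat k)) = dker1 fps_X (of_nat n) (of_nat k)"
  unfolding ker1_def dker1_def by (simp add: theta_ker0 theta_dker0 theta_lsym)

lemma theta_theta2_sym: "theta (theta2_sym fps_X (of_nat n) (of_nat k)) = dtheta2_sym fps_X (of_nat n) (of_nat k)"
  unfolding theta2_sym_def dtheta2_sym_def by (simp add: theta_lsym) (simp add: dlsym_def, algebra)

lemma poly_lsum_ker1: "(1 + fps_X) * theta (poly_lsum ker0) = poly_lsum ker1"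
  unfolding theta_poly_lsum[of ker0 dker0, OF theta_ker0] ker1_def ..

lemma poly_lsum_ker2: "(1 + fps_X) * theta (poly_lsum ker1) = poly_lsum ker2"
  unfolding theta_poly_lsum[of ker1 dker1, OF theta_ker1] ker2_def ..

definition lhs_fps :: "complex fps" where "lhs_fps = lsum (\<lambda>n k. 1)"

lemma theta_lhs_fps: "(1 + fps_X) * theta lhs_fps = poly_lsum lsym"
  using theta_poly_lsum[of "\<lambda>x n k. 1" "\<lambda>x n k. 0"] by (simp add: lhs_fps_def)

lemma theta2_lhs_fps: "(1 + fps_X)^2 * theta (theta lhs_fps) = poly_lsum theta2_sym"
proof -
  \<comment> \<open>Moving \<open>theta\<close> past \<open>1 + fps_X\<close> leaves
    \<open>theta (1 + fps_X) = fps_X\<close>; this is the correction term in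
    \<open>theta2_sym\<close>.\<close>
  have "(1 + fps_X)^2 * theta (theta lhs_fps) = (1 + fps_X) * theta ((1 + fps_X) * theta lhs_fps) - fps_X * ((1 + fps_X) * theta lhs_fps)"
    by (simp add: algebra_simps power2_eq_square)
  also have "\<dots> = poly_lsum theta2_sym"
    unfolding theta_lhs_fps theta_poly_lsum[of lsym dlsym, OF theta_lsym] theta2_sym_def lsum_diff lsum_mult ..
  finally show ?thesis .
qed

lemma theta3_lhs_fps: "(1 + fps_X)^3 * theta (theta (theta lhs_fps)) = poly_lsum theta3_sym"
proof -
  have "(1 + fps_X)^3 * theta (theta (theta lhs_fps)) =
      (1 + fps_X) * theta ((1 + fps_X)^2 * theta (theta lhs_fps)) - 2 * fps_X * ((1 + fps_X)^2 * theta (theta lhs_fps))"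
    by (simp add: algebra_simps power2_eq_square power3_eq_cube)
  also have "\<dots> = poly_lsum theta3_sym"
    unfolding theta2_lhs_fps theta_poly_lsum[of theta2_sym dtheta2_sym, OF theta_theta2_sym] theta3_sym_def lsum_diff lsum_mult ..
  finally show ?thesis .
qed

text \<open>On a series of order at least \<open>n\<close>, the operator multiplies the coefficient
  of degree \<open>n\<close> by \<open>n\<close>. Iterating this reads the indicial equation off a
  differential equation.\<close>

lemma low_order_theta:
  fixes p y :: "complex fps"
  assumes p: "p $ 0 = 1" and y: "\<And>i. i < n \<Longrightarrow> y $ i = 0"
  shows "i < n \<Longrightarrow> (p * theta y) $ i = 0" and "(p * theta y) $ n = of_nat n * y $ n"
proof -
  show "(p * theta y) $ i = 0" if "i < n" for i
    unfolding fps_mult_nth using that y by (intro sum.neutral) auto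
  have "(p * theta y) $ n = (\<Sum>i=0..n. p $ i * theta y $ (n - i))" by (rule fps_mult_nth)
  also have "\<dots> = (\<Sum>i\<in>{0}. p $ i * theta y $ (n - i))"
    using y by (intro sum.mono_neutral_right) auto
  finally show "(p * theta y) $ n = of_nat n * y $ n" by (simp add: p)
qed

lemma low_order_mult:
  fixes q y :: "complex fps"
  assumes "\<And>i. i < n \<Longrightarrow> y $ i = 0"
  shows "(q * y) $ n = q $ 0 * y $ n"
proof -
  have "(q * y) $ n = (\<Sum>i=0..n. q $ i * y $ (n - i))" by (rule fps_mult_nth)
  also have "\<dots> = (\<Sum>i\<in>{0}. q $ i * y $ (n - i))"
    using assms by (intro sum.mono_neutral_right) auto
  finally show ?thesis by simp
qed

lemma poly_lsum_ker0_nth: "poly_lsum ker0 $ 0 = 0" "poly_lsum ker0 $ 1 = 0"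
proof -
  let ?t = "\<lambda>n k. ker0 fps_X (of_nat n) (of_nat k) * lmon n k"
  \<comment> \<open>In degree at most 1 only \<open>n, k \<le> 1\<close> matter: the symbol vanishes
    at \<open>(0, 0)\<close>, \<open>lcoef 0 1 = 0\<close>, the symbol at \<open>(1, 0)\<close> is
    divisible by \<open>fps_X\<close>, and \<open>(1, 1)\<close> starts in degree 2.\<close>
  have z: "ker0 fps_X 0 (0 :: complex fps) = 0" by (simp add: ker0_def)
  have 01: "?t 0 1 $ 1 = 0" by (simp add: lmon_def lcoef_def)
  have 11: "?t 1 1 $ 1 = 0"
    using bigraded_mult[OF bigraded_lmon, of "\<lambda>n k. ker0 fps_X (of_nat n) (of_nat k)",
      unfolded bigraded_def, rule_format, of 1 1 1] by (simp only: less_add_one)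
  have "?t 1 0 = fps_X * ((- 4 - 8 * fps_X - 4 * fps_X^2) * lmon 1 0)"
    unfolding ker0_def by (simp add: algebra_simps power2_eq_square power3_eq_cube)
  also have "\<dots> $ 1 = 0"
    using bigraded_lmon by (simp add: bigraded_def)
  finally have 10: "?t 1 0 $ 1 = 0" .
  show "poly_lsum ker0 $ 0 = 0" unfolding lsum_def dsum_nth by (simp add: z)
  show "poly_lsum ker0 $ 1 = 0" unfolding lsum_def dsum_nth using 01 10 11 by (simp add: z One_nat_def)
qed

lemma poly_lsum_ker0: "poly_lsum ker0 = 0"
proof -
  let ?f = "poly_lsum ker0"
  have "poly_lsum ker2 - (1 + 3*fps_X) * poly_lsum ker1 + fps_X^2 * poly_lsum ker0 = 0"
    unfolding lsum_diff[symmetric] lsum_add[symmetric] lsum_mult[symmetric] kernel_certificate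
    unfolding lsum_add poly_lsum_rel_k poly_lsum_rel_n by simp
  then have eq: "(1 + fps_X) * theta ((1 + fps_X) * theta ?f) = (1 + 3*fps_X) * ((1 + fps_X) * theta ?f) - fps_X^2 * ?f"
    unfolding poly_lsum_ker1 poly_lsum_ker2 by (simp add: algebra_simps)
  have "?f $ n = 0" for n
  proof (induction n rule: less_induct)
    case (less n)
    note 1 = low_order_theta[of "1 + fps_X" n ?f, OF _ less]
    note 2 = low_order_theta[of "1 + fps_X" n "(1 + fps_X) * theta ?f", OF _ 1(1)]
    \<comment> \<open>The indicial equation is \<open>n^2 = n\<close>; its roots 0 and 1 are the two
      degrees settled by \<open>poly_lsum_ker0_nth\<close>.\<close>
    have "of_nat n * (of_nat n * ?f $ n) = of_nat n * ?f $ n"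
      using arg_cong[OF eq, of "\<lambda>g. g $ n"] 1(2) 2(2)
      by (simp add: low_order_mult[OF less] low_order_mult[OF 1(1)])
    then have "of_nat (n * n) * ?f $ n = of_nat n * ?f $ n" by (simp add: mult.assoc)
    then have "?f $ n = 0 \<or> n * n = n" by (metis mult_cancel_right of_nat_eq_iff)
    then show ?case using poly_lsum_ker0_nth by (auto simp: One_nat_def)
  qed
  then show ?thesis by (simp add: fps_eq_iff)
qed

lemma lhs_fps_ode:
  "(1 - 6*fps_X - 47*fps_X^2 - 28*fps_X^3) * theta (theta (theta lhs_fps))
    = (9*fps_X + 141*fps_X^2 + 126*fps_X^3) * theta (theta lhs_fps)
     + (5*fps_X + 145*fps_X^2 + 182*fps_X^3) * theta lhs_fps
     + (fps_X + 51*fps_X^2 + 84*fps_X^3) * lhs_fps"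
proof -
  let ?x = "fps_X :: complex fps"
  have ker1: "poly_lsum ker1 = 0" unfolding poly_lsum_ker1[symmetric] poly_lsum_ker0 by simp
  have A0: "poly_lsum (\<lambda>x n k. 1) = lhs_fps" by (simp add: lhs_fps_def)
  have "poly_lsum (\<lambda>x n k. 2 * x * ((1 - 6*x - 47*x^2 - 28*x^3) * theta3_sym x n k
    - (1 + x) * (9*x + 141*x^2 + 126*x^3) * theta2_sym x n k
    - (1 + x)^2 * (5*x + 145*x^2 + 182*x^3) * lsym x n k
    - (1 + x)^3 * (x + 51*x^2 + 84*x^3) * 1)) = 0"
    unfolding mult_1_right ode_certificate
    unfolding lsum_add lsum_mult poly_lsum_rel_k poly_lsum_rel_n poly_lsum_ker0 ker1 by simp
  then have "2 * ?x * ((1 - 6*?x - 47*?x^2 - 28*?x^3) * poly_lsum theta3_sym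
    - (1 + ?x) * (9*?x + 141*?x^2 + 126*?x^3) * poly_lsum theta2_sym
    - (1 + ?x)^2 * (5*?x + 145*?x^2 + 182*?x^3) * poly_lsum lsym
    - (1 + ?x)^3 * (?x + 51*?x^2 + 84*?x^3) * lhs_fps) = 0"
    unfolding lsum_mult lsum_diff A0 .
  \<comment> \<open>The symbol of the \<open>j\<close>-th derivative carries
    \<open>(1 + x)^j\<close>; the explicit powers in the certificate complete each term to the
    common factor \<open>(1 + x)^3\<close>.\<close>
  then have "2 * ?x * (1 + ?x)^3 * ((1 - 6*?x - 47*?x^2 - 28*?x^3) * theta (theta (theta lhs_fps))
    - (9*?x + 141*?x^2 + 126*?x^3) * theta (theta lhs_fps)
     - (5*?x + 145*?x^2 + 182*?x^3) * theta lhs_fps - (?x + 51*?x^2 + 84*?x^3) * lhs_fps) = 0"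
    unfolding theta_lhs_fps[symmetric] theta2_lhs_fps[symmetric] theta3_lhs_fps[symmetric] by algebra
  moreover have "1 + ?x \<noteq> 0"
    by (metis fps_add_nth fps_one_nth fps_X_nth fps_zero_nth add.right_neutral zero_neq_one)
  ultimately have "(1 - 6*?x - 47*?x^2 - 28*?x^3) * theta (theta (theta lhs_fps))
    - (9*?x + 141*?x^2 + 126*?x^3) * theta (theta lhs_fps)
     - (5*?x + 145*?x^2 + 182*?x^3) * theta lhs_fps - (?x + 51*?x^2 + 84*?x^3) * lhs_fps = 0"
    by (simp only: mult_eq_0_iff power_eq_0_iff fps_X_neq_zero) simp
  then show ?thesis by algebra
qed

subsection \<open>The differential equation in \<open>v\<close>\<close>

text \<open>The chain rule reads \<open>b * theta (a oo b) = theta b * (theta a oo b)\<close>. When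
  \<open>b\<close> has logarithmic derivative \<open>r / q\<close>, the factor \<open>b\<close>
  cancels.\<close>

lemma theta_mult_cancel:
  fixes b :: "complex fps"
  assumes b: "b $ 0 = 0" "b \<noteq> 0" and q: "q * theta b = r * b"
  shows "q * theta (a oo b) = r * (theta a oo b)"
proof -
  have "b * theta (a oo b) = theta b * (theta a oo b)"
    unfolding theta_def fps_compose_deriv[OF b(1)] fps_compose_mult_distrib[OF b(1)]
    using b(1) by (simp add: mult_ac)
  then have "b * (q * theta (a oo b)) = b * (r * (theta a oo b))"
    using q by algebra
  then show ?thesis using b(2) by simp
qed

section \<open>The two substitutions as formal power series\<close>

definition den :: "complex fps" where "den = 1 + 5 * fps_X + 8 * fps_X^2"
definition lin :: "complex fps" where "lin = 1 + 4 * fps_X"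
definition x_fps :: "complex fps" where "x_fps = fps_X * inverse den"
definition t_fps :: "complex fps" where "t_fps = fps_X * inverse lin ^ 3"

lemma den_0: "den $ 0 = 1" and lin_0: "lin $ 0 = 1"
  by (simp_all add: den_def lin_def numeral_fps_const)

lemma x_fps: "den * x_fps = fps_X" and x_fps_0: "x_fps $ 0 = 0"
  and t_fps: "lin^3 * t_fps = fps_X" and t_fps_0: "t_fps $ 0 = 0"
proof -
  have p: "den * inverse den = 1" by (rule inverse_mult_eq_1') (simp add: den_0)
  have q: "lin * inverse lin = 1" by (rule inverse_mult_eq_1') (simp add: lin_0)
  show "den * x_fps = fps_X" unfolding x_fps_def using p by algebra
  have "(lin * inverse lin)^3 = 1" unfolding q by simp
  then show "lin^3 * t_fps = fps_X" unfolding t_fps_def by algebra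
qed (simp_all add: x_fps_def t_fps_def)

lemma x_fps_nz: "x_fps \<noteq> 0" and t_fps_nz: "t_fps \<noteq> 0"
  using x_fps t_fps by (metis mult_zero_right fps_X_neq_zero)+

text \<open>Apply \<open>theta\<close> to \<open>den * x_fps = fps_X\<close>, whose right side it
  fixes.\<close>

lemma theta_x_fps: "den * theta x_fps = (1 - 8 * fps_X^2) * x_fps"
proof -
  have "theta (den * x_fps) = den * x_fps" unfolding x_fps by simp
  then have "den * theta x_fps = (den - theta den) * x_fps" by (simp add: algebra_simps)
  also have "den - theta den = 1 - 8 * fps_X^2"
    unfolding den_def by (simp add: power2_eq_square)
  finally show ?thesis .
qed

lemma theta_t_fps: "lin * theta t_fps = (1 - 8 * fps_X) * t_fps"
proof -
  have "theta (lin^3 * t_fps) = lin^3 * t_fps" unfolding t_fps by simp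
  moreover have "theta lin = 4 * fps_X" by (simp add: lin_def)
  ultimately have "3 * lin^2 * (4 * fps_X) * t_fps + lin^3 * theta t_fps = lin^3 * t_fps" by (simp add: algebra_simps)
  then have "lin^2 * (lin * theta t_fps) = lin^2 * ((lin - 12 * fps_X) * t_fps)" by algebra
  moreover have "lin^2 \<noteq> 0" using lin_0 by auto
  ultimately show ?thesis by (simp add: lin_def)
qed

lemmas theta_simps = theta_add theta_diff theta_minus theta_mult theta_one theta_numeral theta_of_nat
  theta_X theta_X_power

text \<open>The factor \<open>den\<close> keeps all coefficients of the pulled back equations polynomial.\<close>

definition ptheta :: "complex fps \<Rightarrow> complex fps" where "ptheta f = den * theta f"

lemma ptheta_simps: "ptheta (f + g) = ptheta f + ptheta g" "ptheta (f - g) = ptheta f - ptheta g" "ptheta (f * g) = ptheta f * g + f * ptheta g"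
  by (simp_all add: ptheta_def algebra_simps)

definition ode0 :: "'a::idom \<Rightarrow> 'a" where
  "ode0 v = v + 61 * v^2 + 372 * v^3 - 2976 * v^5 - 3904 * v^6 - 512 * v^7"

definition ode1 :: "'a::idom \<Rightarrow> 'a" where
  "ode1 v = 5 * v + 163 * v^2 + 568 * v^3 - 872 * v^4 - 4032 * v^5 - 2048 * v^6"

definition ode2 :: "'a::idom \<Rightarrow> 'a" where
  "ode2 v = 9 * v + 183 * v^2 + 600 * v^3 + 384 * v^4"

text \<open>The equation of \<open>lhs_fps_ode\<close> pulled back along
  \<open>x_fps\<close>.\<close>

definition satisfies_ode :: "complex fps \<Rightarrow> bool" where
  "satisfies_ode Y \<longleftrightarrow> (1 + fps_X) * (1 + 8 * fps_X) * ptheta (ptheta (ptheta Y))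
     = ode2 fps_X * ptheta (ptheta Y) + ode1 fps_X * ptheta Y + ode0 fps_X * Y"

text \<open>The three lower coefficients vanish at \<open>0\<close>, so the indicial equation is
  \<open>n^3 = 0\<close> and only the constant term is free.\<close>

lemma ode_unique:
  fixes Y Z :: "complex fps"
  assumes "satisfies_ode Y" "satisfies_ode Z" "Y $ 0 = Z $ 0"
  shows "Y = Z"
proof -
  define f where "f = Y - Z"
  have eq: "(1 + fps_X) * (1 + 8 * fps_X) * ptheta (ptheta (ptheta f))
     = ode2 fps_X * ptheta (ptheta f) + ode1 fps_X * ptheta f + ode0 fps_X * f"
    using assms(1,2) unfolding satisfies_ode_def f_def ptheta_simps by (simp add: algebra_simps)
  have M: "ode0 fps_X $ 0 = (0::complex)" "ode1 fps_X $ 0 = (0::complex)" "ode2 fps_X $ 0 = (0::complex)"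
    by (simp_all add: ode0_def ode1_def ode2_def numeral_fps_const fps_X_power_iff)
  have "f $ n = 0" for n
  proof (induction n rule: less_induct)
    case (less n)
    note 1 = low_order_theta[of den n f, OF den_0 less, folded ptheta_def]
    note 2 = low_order_theta[of den n "ptheta f", OF den_0 1(1), folded ptheta_def]
    note 3 = low_order_theta[of den n "ptheta (ptheta f)", OF den_0 2(1), folded ptheta_def]
    have "of_nat n * (of_nat n * (of_nat n * f $ n)) = 0"
      using arg_cong[OF eq, of "\<lambda>g. g $ n"] 1(2) 2(2) 3(2)
      by (simp add: low_order_mult[OF less] low_order_mult[OF 1(1)] low_order_mult[OF 2(1)]
          low_order_mult[OF 3(1)] M numeral_fps_const del: mult_eq_0_iff)
    moreover have "f $ 0 = 0" using assms(3) by (simp add: f_def)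
    ultimately show ?case by (cases "n = 0") auto
  qed
  then show ?thesis by (simp add: f_def fps_eq_iff)
qed

lemma fps_compose_numeral: "numeral w oo (b :: complex fps) = numeral w"
  by (simp add: numeral_fps_const)

lemmas compose_simps = fps_compose_add_distrib fps_compose_sub_distrib fps_compose_mult_distrib
  fps_compose_numeral fps_compose_power[symmetric] fps_X_fps_compose_startby0 fps_compose_1

lemma lhs_fps_satisfies_ode: "satisfies_ode (lhs_fps oo x_fps)"
proof -
  define v where "v = (fps_X :: complex fps)"
  define A0 A1 A2 A3 where A: "A0 = lhs_fps oo x_fps" "A1 = theta lhs_fps oo x_fps" "A2 = theta (theta lhs_fps) oo x_fps"
    "A3 = theta (theta (theta lhs_fps)) oo x_fps"
  \<comment> \<open>\<open>e / den\<close> is the logarithmic derivative of \<open>x_fps\<close>;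
    \<open>e2\<close> and \<open>e3\<close> are the first and second \<open>ptheta\<close>
    derivatives of \<open>e\<close>.\<close>
  define e e2 e3 where e: "e = 1 - 8 * v^2" "e2 = - 16 * v^2 - 80 * v^3 - 128 * v^4"
    "e3 = - 32 * v^2 - 400 * v^3 - 1968 * v^4 - 4480 * v^5 - 4096 * v^6"
  have ptheta: "ptheta A0 = e * A1" "ptheta A1 = e * A2" "ptheta A2 = e * A3"
    unfolding A ptheta_def e v_def by (rule theta_mult_cancel[OF x_fps_0 x_fps_nz theta_x_fps])+
  have Ee: "ptheta e = e2" "ptheta e2 = e3"
    unfolding e ptheta_def v_def den_def by - (simp only: theta_simps of_nat_numeral, algebra)+
  have Y1: "ptheta A0 = e * A1" by (rule ptheta)
  have Y2: "ptheta (ptheta A0) = e2 * A1 + e^2 * A2" unfolding ptheta ptheta_simps Ee by algebra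
  have Y3: "ptheta (ptheta (ptheta A0)) = e3 * A1 + 3 * e * e2 * A2 + e^3 * A3"
    unfolding Y2 ptheta_simps power2_eq_square ptheta Ee by algebra
  have p: "den = 1 + 5 * v + 8 * v^2" by (simp add: den_def v_def)
  have "(1 - 6 * x_fps - 47 * x_fps^2 - 28 * x_fps^3) * A3 = (9 * x_fps + 141 * x_fps^2 + 126 * x_fps^3) * A2
     + (5 * x_fps + 145 * x_fps^2 + 182 * x_fps^3) * A1 + (x_fps + 51 * x_fps^2 + 84 * x_fps^3) * A0"
    using arg_cong[OF lhs_fps_ode, of "\<lambda>f. f oo x_fps"]
    by (simp add: compose_simps x_fps_0 A)
  moreover have "den^3 * x_fps = v * den^2" "den^3 * x_fps^2 = v^2 * den" "den^3 * x_fps^3 = v^3"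
    unfolding x_fps[folded v_def, symmetric] by - algebra+
  ultimately have ode: "(den^3 - 6 * (v * den^2) - 47 * (v^2 * den) - 28 * v^3) * A3
     = (9 * (v * den^2) + 141 * (v^2 * den) + 126 * v^3) * A2
     + (5 * (v * den^2) + 145 * (v^2 * den) + 182 * v^3) * A1 + (v * den^2 + 51 * (v^2 * den) + 84 * v^3) * A0"
    by algebra
  \<comment> \<open>In \<open>x\<close> this is \<open>(1 + 4*x) * (1 - 10*x - 7*x^2)\<close>. The
    first factor gives \<open>den + 4*v = (1 + v) * (1 + 8*v)\<close>, the second gives the perfect
    square \<open>e^2\<close>.\<close>
  have c: "den^3 - 6 * (v * den^2) - 47 * (v^2 * den) - 28 * v^3 = (1 + v) * (1 + 8 * v) * e^2"
    unfolding p e by algebra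
  \<comment> \<open>Comparison of the coefficients of \<open>A2\<close>, \<open>A1\<close> and
    \<open>A0\<close> after \<open>A3\<close> has been eliminated.\<close>
  have 2: "3 * ((1 + v) * (1 + 8 * v)) * e * e2 + e * (9 * (v * den^2) + 141 * (v^2 * den) + 126 * v^3) = ode2 v * e^2"
    and 1: "((1 + v) * (1 + 8 * v)) * e3 + e * (5 * (v * den^2) + 145 * (v^2 * den) + 182 * v^3) = ode2 v * e2 + ode1 v * e"
    and 0: "e * (v * den^2 + 51 * (v^2 * den) + 84 * v^3) = ode0 v"
    unfolding ode0_def ode1_def ode2_def p e by - algebra+
  have "(1 + v) * (1 + 8 * v) * ptheta (ptheta (ptheta A0)) = (1 + v) * (1 + 8 * v) * e3 * A1
      + 3 * ((1 + v) * (1 + 8 * v)) * e * e2 * A2 + e * ((1 + v) * (1 + 8 * v) * e^2 * A3)"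
    unfolding Y3 by algebra
  also have "\<dots> = (3 * ((1 + v) * (1 + 8 * v)) * e * e2 + e * (9 * (v * den^2) + 141 * (v^2 * den) + 126 * v^3)) * A2
     + (((1 + v) * (1 + 8 * v)) * e3 + e * (5 * (v * den^2) + 145 * (v^2 * den) + 182 * v^3)) * A1
     + e * (v * den^2 + 51 * (v^2 * den) + 84 * v^3) * A0"
    unfolding ode[unfolded c] by algebra
  also have "\<dots> = ode2 v * ptheta (ptheta A0) + ode1 v * ptheta A0 + ode0 v * A0"
    unfolding 0 1 2 unfolding Y2 unfolding Y1 by algebra
  finally show ?thesis unfolding satisfies_ode_def A v_def .
qed

section \<open>The generating function of \<open>u\<close> and its pullback\<close>

definition u_fps :: "complex fps" where "u_fps = Abs_fps (\<lambda>n. of_int (u n))"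

text \<open>This is the recurrence read coefficientwise: its polynomials expand to
  \<open>26*n^3 + 39*n^2 + 21*n + 4\<close> and, after the index shift,
  \<open>27*n^3 + 81*n^2 + 78*n + 24\<close>.\<close>

lemma u_fps_ode:
  "(1 - 26 * fps_X - 27 * fps_X^2) * theta (theta (theta u_fps))
    = (39 * fps_X + 81 * fps_X^2) * theta (theta u_fps) + (21 * fps_X + 78 * fps_X^2) * theta u_fps + (4 * fps_X + 24 * fps_X^2) * u_fps"
proof -
  have "theta (theta (theta u_fps)) = fps_X * (26 * theta (theta (theta u_fps)) + 39 * theta (theta u_fps) + 21 * theta u_fps + 4 * u_fps)
      + fps_X * (fps_X * (27 * theta (theta (theta u_fps)) + 81 * theta (theta u_fps) + 78 * theta u_fps + 24 * u_fps))"
  proof (rule fps_ext)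
    fix n :: nat
    have num: "(numeral w * f) $ k = numeral w * f $ k" for w k and f :: "complex fps"
      by (simp add: numeral_fps_const)
    consider "n = 0" | "n = 1" | m where "n = m + 2"
      by (metis One_nat_def add_2_eq_Suc' not0_implies_Suc)
    then show "theta (theta (theta u_fps)) $ n = (fps_X * (26 * theta (theta (theta u_fps)) + 39 * theta (theta u_fps) + 21 * theta u_fps + 4 * u_fps)
      + fps_X * (fps_X * (27 * theta (theta (theta u_fps)) + 81 * theta (theta u_fps) + 78 * theta u_fps + 24 * u_fps))) $ n"
    proof cases
      case 1
      then show ?thesis by simp
    next
      \<comment> \<open>The double shift does not reach degree 1; the equation there is
        \<open>u 1 = 4 * u 0\<close>.\<close>
      case 2
      have "u 0 = 1" "u 1 = 4"
        by (simp_all add: u_def numeral_2_eq_2)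
      then have U: "u_fps $ 0 = 1" "u_fps $ 1 = 4" by (simp_all add: u_fps_def)
      have shift: "(fps_X * f) $ 1 = f $ 0" "(fps_X * f) $ 0 = 0" for f :: "complex fps"
        by simp_all
      show ?thesis
        unfolding 2 fps_add_nth shift num theta_nth U by simp
    next
      case (3 m)
      define a x y z where a: "a = (of_nat m :: complex)" "x = complex_of_int (u m)"
        "y = complex_of_int (u (m + 1))" "z = complex_of_int (u (m + 2))"
      have "complex_of_int ((int m + 2)^3 * u (m + 2)) = of_int ((2 * int m + 3) * (13 * (int m + 1)^2 + 13 * (int m + 1) + 4) * u (m + 1)
          + 3 * (int m + 1) * (3 * int m + 2) * (3 * int m + 4) * u m)"
        using u_recurrence[of "m + 1"] by (simp add: add_ac)
      then have rec: "(a + 2)^3 * z = (2 * a + 3) * (13 * (a + 1)^2 + 13 * (a + 1) + 4) * y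
          + 3 * (a + 1) * (3 * a + 2) * (3 * a + 4) * x"
        unfolding a by simp
      have U: "u_fps $ m = x" "u_fps $ (m + 1) = y" "u_fps $ (m + 2) = z"
        by (simp_all add: u_fps_def a)
      have shift: "(fps_X * f) $ (m + 2) = f $ (m + 1)" "(fps_X * f) $ (m + 1) = f $ m" for f :: "complex fps"
        by simp_all
      have idx: "(of_nat (m + 2) :: complex) = a + 2" "(of_nat (m + 1) :: complex) = a + 1" "(of_nat m :: complex) = a"
        by (simp_all add: a)
      show ?thesis
        unfolding 3 fps_add_nth shift num theta_nth U idx using rec by algebra
    qed
  qed
  then show ?thesis by algebra
qed

text \<open>
  If \<open>lin\<^sup>2 * Y = den * (u_fps oo t_fps)\<close>, then \<open>lin ^ (j + 2) * ptheta\<^sup>j Y\<close> is the combination of the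
  series \<open>\<theta>\<^sup>i u_fps oo t_fps\<close> with coefficients \<open>yj_i\<close>.
\<close>

definition y1_0 :: "'a::idom \<Rightarrow> 'a" where
  "y1_0 v = - 3 * v - 19 * v^2 - 44 * v^3 - 32 * v^4"

definition dy1_0 :: "'a::idom \<Rightarrow> 'a" where
  "dy1_0 v = - 3 * v - 38 * v^2 - 132 * v^3 - 128 * v^4"

definition y1_1 :: "'a::idom \<Rightarrow> 'a" where
  "y1_1 v = 1 + 2 * v - 39 * v^2 - 248 * v^3 - 576 * v^4 - 512 * v^5"

definition dy1_1 :: "'a::idom \<Rightarrow> 'a" where
  "dy1_1 v = 2 * v - 78 * v^2 - 744 * v^3 - 2304 * v^4 - 2560 * v^5"

definition y2_0 :: "'a::idom \<Rightarrow> 'a" where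
  "y2_0 v = - 3 * v - 29 * v^2 - 150 * v^3 - 520 * v^4 - 1216 * v^5 - 1664 * v^6 - 1024 * v^7"

definition dy2_0 :: "'a::idom \<Rightarrow> 'a" where
  "dy2_0 v = - 3 * v - 58 * v^2 - 450 * v^3 - 2080 * v^4 - 6080 * v^5 - 9984 * v^6 - 7168 * v^7"

definition y2_1 :: "'a::idom \<Rightarrow> 'a" where
  "y2_1 v = - 13 * v - 154 * v^2 - 1029 * v^3 - 5096 * v^4 - 18368 * v^5 - 43008 * v^6 - 57344 * v^7 - 32768 * v^8"

definition dy2_1 :: "'a::idom \<Rightarrow> 'a" where
  "dy2_1 v = - 13 * v - 308 * v^2 - 3087 * v^3 - 20384 * v^4 - 91840 * v^5 - 258048 * v^6 - 401408 * v^7 - 262144 * v^8"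

definition y2_2 :: "'a::idom \<Rightarrow> 'a" where
  "y2_2 v = 1 - v - 77 * v^2 - 259 * v^3 + 1288 * v^4 + 11648 * v^5 + 35840 * v^6 + 53248 * v^7 + 32768 * v^8"

definition dy2_2 :: "'a::idom \<Rightarrow> 'a" where
  "dy2_2 v = - v - 154 * v^2 - 777 * v^3 + 5152 * v^4 + 58240 * v^5 + 215040 * v^6 + 372736 * v^7 + 262144 * v^8"

definition y3_0 :: "'a::idom \<Rightarrow> 'a" where
  "y3_0 v = - 3 * v - 37 * v^2 - 352 * v^3 - 2746 * v^4 - 15224 * v^5 - 57088 * v^6 - 143360 * v^7 - 233472 * v^8 - 225280 * v^9 - 98304 * v^10"

definition y3_1 :: "'a::idom \<Rightarrow> 'a" where
  "y3_1 v = - 16 * v - 237 * v^2 - 2686 * v^3 - 25709 * v^4 - 181020 * v^5 - 892640 * v^6 - 3061632 * v^7 - 7195648 * v^8 - 11100160 * v^9 - 10158080 * v^10 - 4194304 * v^11"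

definition y3_2 :: "'a::idom \<Rightarrow> 'a" where
  "y3_2 v = - 30 * v - 342 * v^2 - 1158 * v^3 + 7998 * v^4 + 127596 * v^5 + 843360 * v^6 + 3419136 * v^7 + 8982528 * v^8 + 14991360 * v^9 + 14548992 * v^10 + 6291456 * v^11"

definition y3_3 :: "'a::idom \<Rightarrow> 'a" where
  "y3_3 v = 1 - 4 * v - 106 * v^2 - 60 * v^3 + 4593 * v^4 + 21000 * v^5 - 23744 * v^6 - 509440 * v^7 - 2019328 * v^8 - 4096000 * v^9 - 4456448 * v^10 - 2097152 * v^11"

lemma u_fps_satisfies_ode:
  assumes Y: "lin^2 * Y = den * (u_fps oo t_fps)"
  shows "satisfies_ode Y"
proof -
  define v where "v = (fps_X :: complex fps)"
  define A0 A1 A2 A3 where A: "A0 = u_fps oo t_fps" "A1 = theta u_fps oo t_fps" "A2 = theta (theta u_fps) oo t_fps"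
    "A3 = theta (theta (theta u_fps)) oo t_fps"
  \<comment> \<open>\<open>f / lin\<close> is the logarithmic derivative of \<open>t_fps\<close>;
    \<open>s\<close> below is the leading coefficient in \<open>satisfies_ode\<close>.\<close>
  define f where "f = 1 - 8 * v"
  define s where "s = (1 + v) * (1 + 8 * v)"
  have p: "den = 1 + 5 * v + 8 * v^2" and q: "lin = 1 + 4 * v" by (simp_all add: den_def lin_def v_def)
  have pA: "lin * ptheta A0 = den * f * A1" "lin * ptheta A1 = den * f * A2" "lin * ptheta A2 = den * f * A3"
    using theta_mult_cancel[OF t_fps_0 t_fps_nz theta_t_fps, of u_fps] theta_mult_cancel[OF t_fps_0 t_fps_nz theta_t_fps, of "theta u_fps"]
      theta_mult_cancel[OF t_fps_0 t_fps_nz theta_t_fps, of "theta (theta u_fps)"]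
    unfolding A ptheta_def f_def v_def by - algebra+
  have Ep: "ptheta den = den * (5 * v + 16 * v^2)" and Eq: "ptheta lin = den * (4 * v)"
    unfolding ptheta_def by (simp_all add: den_def lin_def v_def power2_eq_square)
  have Ea: "ptheta (y1_0 v) = den * dy1_0 v" "ptheta (y1_1 v) = den * dy1_1 v" "ptheta (y2_0 v) = den * dy2_0 v"
    "ptheta (y2_1 v) = den * dy2_1 v" "ptheta (y2_2 v) = den * dy2_2 v"
    unfolding ptheta_def v_def y1_0_def dy1_0_def y1_1_def dy1_1_def y2_0_def dy2_0_def y2_1_def dy2_1_def y2_2_def dy2_2_def
    by (simp_all only: theta_simps of_nat_numeral) algebra+
  \<comment> \<open>The product-rule recursion for the coefficients \<open>yj_i\<close>; the
    subtracted terms come from differentiating the power of \<open>lin\<close>.\<close>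
  have pa: "lin * (den * (5 * v + 16 * v^2)) - 2 * (den * (4 * v)) * den = y1_0 v" "den * (den * f) = y1_1 v"
    and pb: "lin * (den * dy1_0 v) - 3 * (den * (4 * v)) * y1_0 v = y2_0 v"
      "den * f * y1_0 v + lin * (den * dy1_1 v) - 3 * (den * (4 * v)) * y1_1 v = y2_1 v"
      "den * f * y1_1 v = y2_2 v"
    and pk: "lin * (den * dy2_0 v) - 4 * (den * (4 * v)) * y2_0 v = y3_0 v"
      "den * f * y2_0 v + lin * (den * dy2_1 v) - 4 * (den * (4 * v)) * y2_1 v = y3_1 v"
      "den * f * y2_1 v + lin * (den * dy2_2 v) - 4 * (den * (4 * v)) * y2_2 v = y3_2 v"
      "den * f * y2_2 v = y3_3 v"
    unfolding p q f_def y1_0_def dy1_0_def y1_1_def dy1_1_def y2_0_def dy2_0_def y2_1_def dy2_1_def y2_2_def dy2_2_def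
      y3_0_def y3_1_def y3_2_def y3_3_def
    by - algebra+
  have Y1: "lin^3 * ptheta Y = y1_0 v * A0 + y1_1 v * A1"
  proof -
    have "lin * (2 * lin * ptheta lin * Y + lin^2 * ptheta Y) = lin * (ptheta den * A0 + den * ptheta A0)"
      using arg_cong[OF Y, of ptheta] unfolding ptheta_simps power2_eq_square A(1)[symmetric] by algebra
    then have "lin^3 * ptheta Y = lin * ptheta den * A0 - 2 * ptheta lin * (den * A0) + den * (lin * ptheta A0)"
      using Y[folded A(1)] by algebra
    also have "\<dots> = (lin * ptheta den - 2 * ptheta lin * den) * A0 + den * (den * f) * A1"
      unfolding pA by algebra
    finally show ?thesis unfolding Ep Eq pa .
  qed
  have Y2: "lin^4 * ptheta (ptheta Y) = y2_0 v * A0 + y2_1 v * A1 + y2_2 v * A2"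
  proof -
    have "lin * (3 * lin^2 * ptheta lin * ptheta Y + lin^3 * ptheta (ptheta Y))
        = lin * (ptheta (y1_0 v) * A0 + y1_0 v * ptheta A0 + ptheta (y1_1 v) * A1 + y1_1 v * ptheta A1)"
      using arg_cong[OF Y1, of ptheta] unfolding ptheta_simps power2_eq_square power3_eq_cube by algebra
    then have "lin^4 * ptheta (ptheta Y) = lin * ptheta (y1_0 v) * A0 + lin * ptheta (y1_1 v) * A1 - 3 * ptheta lin * (y1_0 v * A0 + y1_1 v * A1)
        + y1_0 v * (lin * ptheta A0) + y1_1 v * (lin * ptheta A1)"
      using Y1 by algebra
    also have "\<dots> = (lin * ptheta (y1_0 v) - 3 * ptheta lin * y1_0 v) * A0
        + (den * f * y1_0 v + lin * ptheta (y1_1 v) - 3 * ptheta lin * y1_1 v) * A1 + (den * f * y1_1 v) * A2"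
      unfolding pA by algebra
    finally show ?thesis unfolding Ea Eq pb .
  qed
  have Y3: "lin^5 * ptheta (ptheta (ptheta Y)) = y3_0 v * A0 + y3_1 v * A1 + y3_2 v * A2 + y3_3 v * A3"
  proof -
    have q4: "ptheta (lin^4) = 4 * lin^3 * ptheta lin"
      unfolding power4_eq_xxxx power3_eq_cube ptheta_simps by algebra
    have "lin * (4 * lin^3 * ptheta lin * ptheta (ptheta Y) + lin^4 * ptheta (ptheta (ptheta Y)))
        = lin * (ptheta (y2_0 v) * A0 + y2_0 v * ptheta A0 + ptheta (y2_1 v) * A1 + y2_1 v * ptheta A1 + ptheta (y2_2 v) * A2 + y2_2 v * ptheta A2)"
      using arg_cong[OF Y2, of ptheta] unfolding ptheta_simps q4 by algebra
    then have "lin^5 * ptheta (ptheta (ptheta Y)) = lin * ptheta (y2_0 v) * A0 + lin * ptheta (y2_1 v) * A1 + lin * ptheta (y2_2 v) * A2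
        - 4 * ptheta lin * (y2_0 v * A0 + y2_1 v * A1 + y2_2 v * A2)
        + y2_0 v * (lin * ptheta A0) + y2_1 v * (lin * ptheta A1) + y2_2 v * (lin * ptheta A2)"
      using Y2 by algebra
    also have "\<dots> = (lin * ptheta (y2_0 v) - 4 * ptheta lin * y2_0 v) * A0
        + (den * f * y2_0 v + lin * ptheta (y2_1 v) - 4 * ptheta lin * y2_1 v) * A1
        + (den * f * y2_1 v + lin * ptheta (y2_2 v) - 4 * ptheta lin * y2_2 v) * A2 + (den * f * y2_2 v) * A3"
      unfolding pA by algebra
    finally show ?thesis unfolding Ea Eq pk .
  qed
  have "(1 - 26 * t_fps - 27 * t_fps^2) * A3 = (39 * t_fps + 81 * t_fps^2) * A2 + (21 * t_fps + 78 * t_fps^2) * A1 + (4 * t_fps + 24 * t_fps^2) * A0"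
    using arg_cong[OF u_fps_ode, of "\<lambda>f. f oo t_fps"]
    by (simp add: compose_simps t_fps_0 A)
  moreover have "lin^6 * t_fps = v * lin^3" "lin^6 * t_fps^2 = v^2"
    unfolding t_fps[folded v_def, symmetric] by - algebra+
  ultimately have ode: "(lin^6 - 26 * (v * lin^3) - 27 * v^2) * A3 = (39 * (v * lin^3) + 81 * v^2) * A2
      + (21 * (v * lin^3) + 78 * v^2) * A1 + (4 * (v * lin^3) + 24 * v^2) * A0"
    by algebra
  \<comment> \<open>In \<open>t\<close> the last factor is \<open>(1 - 27*t) * (1 + t)\<close>,
    where \<open>lin^3 - 27*v = (1 + v) * f^2\<close> and
    \<open>lin^3 + v = (1 + 8*v) * den\<close>; moreover
    \<open>y3_3 v = den^4 * f^3\<close>.\<close>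
  have c3: "s * y3_3 v = den^3 * f * (lin^6 - 26 * (v * lin^3) - 27 * v^2)"
    unfolding s_def p q f_def y3_3_def by algebra
  \<comment> \<open>The coefficients of \<open>A2\<close>, \<open>A1\<close>, \<open>A0\<close> that
    remain when \<open>ode\<close> is used to eliminate \<open>A3\<close>.\<close>
  have c: "s * y3_2 v - ode2 v * lin * y2_2 v + den^3 * f * (39 * (v * lin^3) + 81 * v^2) = 0"
    "s * y3_1 v - ode2 v * lin * y2_1 v - ode1 v * lin^2 * y1_1 v + den^3 * f * (21 * (v * lin^3) + 78 * v^2) = 0"
    "s * y3_0 v - ode2 v * lin * y2_0 v - ode1 v * lin^2 * y1_0 v - ode0 v * lin^3 * den + den^3 * f * (4 * (v * lin^3) + 24 * v^2) = 0"
    unfolding s_def p q f_def y3_2_def y3_1_def y3_0_def y2_2_def y2_1_def y2_0_def y1_1_def y1_0_def ode2_def ode1_def ode0_def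
    by - algebra+
  have "lin^5 * (s * ptheta (ptheta (ptheta Y)) - ode2 v * ptheta (ptheta Y) - ode1 v * ptheta Y - ode0 v * Y)
    = s * (lin^5 * ptheta (ptheta (ptheta Y))) - ode2 v * lin * (lin^4 * ptheta (ptheta Y)) - ode1 v * lin^2 * (lin^3 * ptheta Y) - ode0 v * lin^3 * (lin^2 * Y)"
    by algebra
  also have "\<dots> = (s * y3_3 v) * A3 + (s * y3_2 v - ode2 v * lin * y2_2 v) * A2
     + (s * y3_1 v - ode2 v * lin * y2_1 v - ode1 v * lin^2 * y1_1 v) * A1
     + (s * y3_0 v - ode2 v * lin * y2_0 v - ode1 v * lin^2 * y1_0 v - ode0 v * lin^3 * den) * A0"
    unfolding Y3 Y2 Y1 Y[folded A(1)] by algebra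
  also have "(s * y3_3 v) * A3 = den^3 * f * ((39 * (v * lin^3) + 81 * v^2) * A2
      + (21 * (v * lin^3) + 78 * v^2) * A1 + (4 * (v * lin^3) + 24 * v^2) * A0)"
    unfolding c3 ode[symmetric] by algebra
  also have "\<dots> + (s * y3_2 v - ode2 v * lin * y2_2 v) * A2
     + (s * y3_1 v - ode2 v * lin * y2_1 v - ode1 v * lin^2 * y1_1 v) * A1
     + (s * y3_0 v - ode2 v * lin * y2_0 v - ode1 v * lin^2 * y1_0 v - ode0 v * lin^3 * den) * A0
     = (s * y3_2 v - ode2 v * lin * y2_2 v + den^3 * f * (39 * (v * lin^3) + 81 * v^2)) * A2
     + (s * y3_1 v - ode2 v * lin * y2_1 v - ode1 v * lin^2 * y1_1 v + den^3 * f * (21 * (v * lin^3) + 78 * v^2)) * A1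
     + (s * y3_0 v - ode2 v * lin * y2_0 v - ode1 v * lin^2 * y1_0 v - ode0 v * lin^3 * den + den^3 * f * (4 * (v * lin^3) + 24 * v^2)) * A0"
    by algebra
  also have "\<dots> = 0" unfolding c by simp
  finally have "lin^5 * (s * ptheta (ptheta (ptheta Y)) - ode2 v * ptheta (ptheta Y) - ode1 v * ptheta Y - ode0 v * Y) = 0" .
  moreover have "lin^5 \<noteq> 0" using lin_0 by auto
  ultimately have "s * ptheta (ptheta (ptheta Y)) - ode2 v * ptheta (ptheta Y) - ode1 v * ptheta Y - ode0 v * Y = 0"
    by (metis mult_eq_0_iff)
  then show ?thesis unfolding satisfies_ode_def s_def v_def by algebra
qed

text \<open>Both \<open>lhs_fps oo x_fps\<close> and \<open>den / lin^2\<close> times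
  \<open>u_fps oo t_fps\<close> solve the pulled back equation with constant term 1.\<close>

lemma compose_identity: "lin^2 * (lhs_fps oo x_fps) = den * (u_fps oo t_fps)"
proof -
  define Y where "Y = inverse (lin^2) * (den * (u_fps oo t_fps))"
  have q0: "(lin^2) $ 0 = 1" by (simp add: power2_eq_square lin_0)
  have "lin^2 * inverse (lin^2) = 1" by (rule inverse_mult_eq_1') (simp add: q0)
  then have Y: "lin^2 * Y = den * (u_fps oo t_fps)" unfolding Y_def by algebra
  have "lhs_fps $ 0 = 1"
    by (simp add: lhs_fps_def lsum_def dsum_nth lmon_def lcoef_def inv1X_def)
  moreover have "Y $ 0 = 1"
    by (simp add: Y_def q0 den_0 u_fps_def u_def)
  ultimately have "lhs_fps oo x_fps = Y"
    using ode_unique[OF lhs_fps_satisfies_ode u_fps_satisfies_ode[OF Y]] by simp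
  then show ?thesis using Y by simp
qed

subsection \<open>Convergence\<close>

text \<open>By the Weierstrass test the sum is holomorphic and its Taylor coefficients are limits of
  those of the partial sums. The order condition makes these sequences eventually constant, hence
  the finite sums.\<close>

lemma suminf_has_fps_expansion:
  fixes f :: "nat \<Rightarrow> complex \<Rightarrow> complex"
  assumes r: "r > 0"
    and hol: "\<And>n. f n holomorphic_on ball 0 r"
    and bound: "\<And>n x. x \<in> ball 0 r \<Longrightarrow> norm (f n x) \<le> c n"
    and c: "summable c"
    and exp: "\<And>n. f n has_fps_expansion \<phi> n"
    and order: "\<And>n m. m < n \<Longrightarrow> fps_nth (\<phi> n) m = 0"
  shows "(\<lambda>x. \<Sum>n. f n x) has_fps_expansion Abs_fps (\<lambda>m. \<Sum>n\<le>m. fps_nth (\<phi> n) m)"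
proof -
  define g where "g = (\<lambda>x. \<Sum>n. f n x)"
  define P where "P = (\<lambda>N x. \<Sum>n<N. f n x)"
  have ulim: "uniform_limit (ball 0 r) P g sequentially"
    unfolding P_def g_def using bound c by (rule Weierstrass_m_test)
  have P_hol: "P N holomorphic_on ball 0 r" for N
    unfolding P_def using hol by (intro holomorphic_on_sum)
  have "g holomorphic_on ball 0 r"
  proof (rule holomorphic_uniform_sequence[OF open_ball P_hol])
    fix x :: complex assume "x \<in> ball 0 r"
    then obtain d where "d > 0" "cball x d \<subseteq> ball 0 r"
      using open_contains_cball open_ball by blast
    then show "\<exists>d. 0 < d \<and> cball x d \<subseteq> ball 0 r \<and> uniform_limit (cball x d) P g sequentially"
      using uniform_limit_on_subset[OF ulim] by blast
  qed
  then have g_exp: "g has_fps_expansion fps_expansion g 0"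
    using r by (intro has_fps_expansion_fps_expansion[of "ball 0 r"]) auto
  have "fps_nth (fps_expansion g 0) m = (\<Sum>n\<le>m. fps_nth (\<phi> n) m)" for m
  proof -
    have P_nth: "(deriv ^^ m) (P N) 0 / fact m = (\<Sum>n<N. fps_nth (\<phi> n) m)" for N
    proof -
      have "P N has_fps_expansion (\<Sum>n<N. \<phi> n)"
        unfolding P_def by (intro has_fps_expansion_sum exp)
      from fps_nth_fps_expansion[OF this, of m] show ?thesis
        by (simp add: fps_sum_nth)
    qed
    have "(\<lambda>N. (deriv ^^ m) (P N) 0) \<longlonglongrightarrow> (deriv ^^ m) g 0"
      by (rule higher_deriv_complex_uniform_limit[OF ulim]) (use r P_hol in auto)
    then have "(\<lambda>N. (deriv ^^ m) (P N) 0 / fact m) \<longlonglongrightarrow> (deriv ^^ m) g 0 / fact m"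
      by (intro tendsto_divide) auto
    then have "(\<lambda>N. \<Sum>n<N. fps_nth (\<phi> n) m) \<longlonglongrightarrow> fps_nth (fps_expansion g 0) m"
      unfolding P_nth fps_nth_fps_expansion[OF g_exp] .
    moreover have "(\<Sum>n<N. fps_nth (\<phi> n) m) = (\<Sum>n\<le>m. fps_nth (\<phi> n) m)" if "N \<ge> Suc m" for N
      using that order by (intro sum.mono_neutral_right) auto
    then have "(\<lambda>N. \<Sum>n<N. fps_nth (\<phi> n) m) \<longlonglongrightarrow> (\<Sum>n\<le>m. fps_nth (\<phi> n) m)"
      by (intro tendsto_eventually eventually_sequentiallyI[of "Suc m"])
    ultimately show ?thesis using LIMSEQ_unique by blast
  qed
  then have "fps_expansion g 0 = Abs_fps (\<lambda>m. \<Sum>n\<le>m. fps_nth (\<phi> n) m)"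
    by (simp add: fps_eq_iff)
  with g_exp show ?thesis by (simp add: g_def)
qed

section \<open>The left-hand side as a function of \<open>x\<close>\<close>

definition gl_term :: "nat \<Rightarrow> complex \<Rightarrow> complex" where
  "gl_term n x = of_nat ((2 * n) choose n) * (x / (1 + x)^2) ^ n *
     (\<Sum>k\<le>n. of_nat ((n choose k) * ((n + k) choose n) * ((2 * k) choose k)) * x ^ k)"

lemma lhs_term_eq: "lhs_term v n = gl_term n (x_of v)"
  by (simp add: lhs_term_def gl_term_def z_of_def atLeast0AtMost)

text \<open>The radius is chosen so that the bounds \<open>4^n\<close> for the central binomial,
  \<open>(4 / 1024)^n\<close> for the power of \<open>z\<close> and \<open>32^n\<close> for the
  inner sum multiply to \<open>(1 / 2)^n\<close>.\<close>

lemma norm_gl_term: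
  assumes "norm x < 1 / 1024"
  shows "norm (gl_term n x) \<le> (1 / 2) ^ n"
proof -
  have z: "norm (x / (1 + x)^2) \<le> 4 / 1024"
  proof -
    have "1 - norm x \<le> norm (1 + x)" by (metis norm_diff_ineq norm_one)
    then have "(1 / 2)^2 \<le> norm (1 + x)^2"
      using assms by (intro power_mono) auto
    then have "norm x / norm (1 + x)^2 \<le> norm x / (1 / 2)^2"
      by (intro divide_left_mono) (auto simp: power2_eq_square intro!: mult_pos_pos)
    moreover have "norm x / (1 / 2)^2 = 4 * norm x" by (simp add: power2_eq_square)
    ultimately show ?thesis unfolding norm_divide norm_power using assms by linarith
  qed
  have s: "norm (\<Sum>k\<le>n. of_nat ((n choose k) * ((n + k) choose n) * ((2 * k) choose k)) * x ^ k) \<le> 32 ^ n"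
  proof -
    have "norm (\<Sum>k\<le>n. of_nat ((n choose k) * ((n + k) choose n) * ((2 * k) choose k)) * x ^ k)
        \<le> (\<Sum>k\<le>n. real (n choose k) * 16 ^ n)"
    proof (rule sum_norm_le)
      fix k assume "k \<in> {..n}"
      then have k: "k \<le> n" by simp
      have "(n + k) choose n \<le> 2 ^ (n + k)" by (rule binomial_le_pow2)
      also have "\<dots> \<le> 2 ^ (2 * n)" using k by (intro power_increasing) auto
      finally have 1: "(n + k) choose n \<le> 4 ^ n" by (simp add: power_mult)
      have "(2 * k) choose k \<le> 2 ^ (2 * k)" by (rule binomial_le_pow2)
      also have "\<dots> \<le> 2 ^ (2 * n)" using k by (intro power_increasing) auto
      finally have 2: "(2 * k) choose k \<le> 4 ^ n" by (simp add: power_mult)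
      have "(n choose k) * ((n + k) choose n) * ((2 * k) choose k) \<le> (n choose k) * (4 ^ n * 4 ^ n)"
        unfolding mult.assoc by (intro mult_le_mono order_refl 1 2)
      also have "(4 ^ n * 4 ^ n :: nat) = 16 ^ n" by (simp flip: power_mult_distrib)
      finally have "real ((n choose k) * ((n + k) choose n) * ((2 * k) choose k)) \<le> real ((n choose k) * 16 ^ n)"
        by (rule of_nat_mono)
      moreover have "norm (x ^ k) \<le> 1"
        using assms by (simp add: norm_power power_le_one)
      ultimately have "real ((n choose k) * ((n + k) choose n) * ((2 * k) choose k)) * norm (x ^ k) \<le> real ((n choose k) * 16 ^ n) * 1"
        by (intro mult_mono) auto
      then show "norm (of_nat ((n choose k) * ((n + k) choose n) * ((2 * k) choose k)) * x ^ k) \<le> real (n choose k) * 16 ^ n"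
        by (simp add: norm_mult)
    qed
    also have "\<dots> = real (\<Sum>k\<le>n. n choose k) * 16 ^ n"
      by (simp add: sum_distrib_right)
    also have "\<dots> = 32 ^ n" unfolding choose_row_sum by (simp flip: power_mult_distrib)
    finally show ?thesis .
  qed
  have c: "norm (of_nat ((2 * n) choose n) :: complex) \<le> 4 ^ n"
  proof -
    have "(2 * n) choose n \<le> 4 ^ n" using binomial_le_pow2[of "2 * n" n] by (simp add: power_mult)
    then have "real ((2 * n) choose n) \<le> real (4 ^ n)" by (rule of_nat_mono)
    then show ?thesis by simp
  qed
  have "norm (gl_term n x) \<le> 4 ^ n * (4 / 1024) ^ n * 32 ^ n"
    unfolding gl_term_def norm_mult norm_power[of "x / (1 + x)^2"]
    by (intro mult_mono c s power_mono z mult_nonneg_nonneg) auto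
  also have "\<dots> = (1 / 2) ^ n" by (simp flip: power_mult_distrib)
  finally show ?thesis .
qed

lemma summable_half: "summable (\<lambda>n. (1 / 2 :: real) ^ n)"
  by (rule summable_geometric) simp

text \<open>The factor \<open>1 + fps_X\<close> undoes the extra \<open>1 / (1 + x)\<close> in
  \<open>lmon\<close>.\<close>

lemma gl_has_fps_expansion: "(\<lambda>x. \<Sum>n. gl_term n x) has_fps_expansion (1 + fps_X) * lhs_fps"
proof -
  define \<phi> :: "nat \<Rightarrow> complex fps" where "\<phi> = (\<lambda>n. \<Sum>k\<le>n. of_nat (lcoef n k) * fps_X ^ (n + k) * inv1X ^ (2 * n))"
  have nz: "1 + x \<noteq> 0" if "x \<in> ball 0 (1 / 1024)" for x :: complex
  proof
    assume "1 + x = 0"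
    then have "norm x = 1" by (metis add_eq_0_iff norm_minus_cancel norm_one)
    then show False using that by simp
  qed
  have exp: "gl_term n has_fps_expansion \<phi> n" for n
  proof -
    have "(\<lambda>x::complex. of_nat ((2 * n) choose n) * (x * inverse (1 + x)^2) ^ n *
      (\<Sum>k\<le>n. of_nat ((n choose k) * ((n + k) choose n) * ((2 * k) choose k)) * x ^ k)) has_fps_expansion
      fps_const (of_nat ((2 * n) choose n)) * (fps_X * inverse (1 + fps_X)^2) ^ n *
      (\<Sum>k\<le>n. fps_const (of_nat ((n choose k) * ((n + k) choose n) * ((2 * k) choose k))) * fps_X ^ k)"
      by (intro fps_expansion_intros) auto
    also have "(\<lambda>x::complex. of_nat ((2 * n) choose n) * (x * inverse (1 + x)^2) ^ n *
      (\<Sum>k\<le>n. of_nat ((n choose k) * ((n + k) choose n) * ((2 * k) choose k)) * x ^ k)) = gl_term n"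
      by (simp add: fun_eq_iff gl_term_def field_simps)
    also have "fps_const (of_nat ((2 * n) choose n)) * (fps_X * inverse (1 + fps_X)^2) ^ n *
      (\<Sum>k\<le>n. fps_const (of_nat ((n choose k) * ((n + k) choose n) * ((2 * k) choose k))) * fps_X ^ k) = \<phi> n"
    proof -
      have "(fps_X * inv1X^2) ^ n = fps_X ^ n * inv1X ^ (2 * n)"
        by (simp add: power_mult_distrib power_mult)
      then show ?thesis
        unfolding \<phi>_def sum_distrib_left inv1X_def[symmetric] fps_of_nat
        unfolding lcoef_def of_nat_mult power_add by (intro sum.cong refl) (simp only: mult_ac)
    qed
    finally show ?thesis .
  qed
  have low: "fps_nth (of_nat (lcoef n k) * fps_X ^ (n + k) * inv1X ^ (2 * n)) m = 0" if "m < n + k" for n k m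
  proof -
    have eq: "of_nat (lcoef n k) * fps_X ^ (n + k) * inv1X ^ (2 * n) = fps_X ^ (n + k) * (of_nat (lcoef n k) * inv1X ^ (2 * n))"
      by (simp only: mult_ac)
    show ?thesis unfolding eq using that by (simp add: fps_X_power_mult_nth)
  qed
  have "(\<lambda>x. \<Sum>n. gl_term n x) has_fps_expansion Abs_fps (\<lambda>m. \<Sum>n\<le>m. fps_nth (\<phi> n) m)"
  proof (rule suminf_has_fps_expansion[where r = "1 / 1024", OF _ _ _ summable_half])
    show "gl_term n holomorphic_on ball 0 (1 / 1024)" for n
      unfolding gl_term_def using nz by (intro holomorphic_intros) auto
    show "fps_nth (\<phi> n) m = 0" if "m < n" for n m
      unfolding \<phi>_def fps_sum_nth using that by (intro sum.neutral ballI low) auto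
  qed (use norm_gl_term exp in auto)
  also have "Abs_fps (\<lambda>m. \<Sum>n\<le>m. fps_nth (\<phi> n) m) = (1 + fps_X) * lhs_fps"
  proof (rule fps_ext)
    fix m
    have "(1 + fps_X) * lmon n k = of_nat (lcoef n k) * fps_X ^ (n + k) * inv1X ^ (2 * n) * ((1 + fps_X) * inv1X)" for n k
      unfolding lmon_def by (simp add: mult_ac)
    then have lmon: "(1 + fps_X) * lmon n k = of_nat (lcoef n k) * fps_X ^ (n + k) * inv1X ^ (2 * n)" for n k
      unfolding inv1X by simp
    have "(1 + fps_X) * lhs_fps = dsum (\<lambda>n k. (1 + fps_X) * lmon n k)"
      unfolding lhs_fps_def lsum_def by (simp add: dsum_mult[OF bigraded_lmon])
    then have "fps_nth ((1 + fps_X) * lhs_fps) m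
        = (\<Sum>n\<le>m. \<Sum>k\<le>m. fps_nth (of_nat (lcoef n k) * fps_X ^ (n + k) * inv1X ^ (2 * n)) m)"
      by (simp only: lmon dsum_nth)
    also have "\<dots> = (\<Sum>n\<le>m. fps_nth (\<phi> n) m)"
    proof (intro sum.cong refl)
      have cf_eq_0: "lcoef n k = 0" if "n < k" for n k
        using that by (simp add: lcoef_def binomial_eq_0)
      fix n assume "n \<in> {..m}"
      then show "(\<Sum>k\<le>m. fps_nth (of_nat (lcoef n k) * fps_X ^ (n + k) * inv1X ^ (2 * n)) m) = fps_nth (\<phi> n) m"
        unfolding \<phi>_def fps_sum_nth
        by (intro sum.mono_neutral_right ballI) (auto simp: cf_eq_0)
    qed
    finally show "fps_nth (Abs_fps (\<lambda>m. \<Sum>n\<le>m. fps_nth (\<phi> n) m)) m = fps_nth ((1 + fps_X) * lhs_fps) m"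
      by simp
  qed
  finally show ?thesis .
qed

section \<open>The generating function of \<open>u\<close> as a function of \<open>t\<close>\<close>

definition u_monom :: "nat \<Rightarrow> complex \<Rightarrow> complex" where
  "u_monom n t = of_int (u n) * t ^ n"

text \<open>One factor \<open>n choose k\<close> is summed to \<open>2^n\<close>; the other three
  binomials are at most \<open>32^n\<close> together. So \<open>u n \<le> 64^n\<close>, and the
  radius leaves a ratio of \<open>1 / 2\<close>.\<close>

lemma norm_u_monom:
  assumes "norm t < 1 / 128"
  shows "norm (u_monom n t) \<le> (1 / 2) ^ n"
proof -
  have "\<bar>u n\<bar> \<le> 64 ^ n"
  proof -
    have "u n \<le> (\<Sum>k\<le>n. int ((n choose k) * 32 ^ n))"
      unfolding u_def atLeast0AtMost
    proof (intro sum_mono of_nat_mono)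
      fix k assume "k \<in> {..n}"
      then have k: "k \<le> n" by simp
      have 0: "n choose k \<le> 2 ^ n" by (rule binomial_le_pow2)
      have "(n + k) choose n \<le> 2 ^ (n + k)" by (rule binomial_le_pow2)
      also have "\<dots> \<le> 2 ^ (2 * n)" using k by (intro power_increasing) auto
      finally have 1: "(n + k) choose n \<le> 4 ^ n" by (simp add: power_mult)
      have "(2 * k) choose n \<le> 2 ^ (2 * k)" by (rule binomial_le_pow2)
      also have "\<dots> \<le> 2 ^ (2 * n)" using k by (intro power_increasing) auto
      finally have 2: "(2 * k) choose n \<le> 4 ^ n" by (simp add: power_mult)
      have "(n choose k)^2 * ((n + k) choose n) * ((2 * k) choose n) \<le> (n choose k) * (2 ^ n * (4 ^ n * 4 ^ n))"
        unfolding mult.assoc power2_eq_square by (intro mult_le_mono order_refl 0 1 2)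
      also have "(2 ^ n * (4 ^ n * 4 ^ n) :: nat) = 32 ^ n" by (simp flip: power_mult_distrib)
      finally show "(n choose k)^2 * ((n + k) choose n) * ((2 * k) choose n) \<le> (n choose k) * 32 ^ n" .
    qed
    also have "\<dots> = int ((\<Sum>k\<le>n. n choose k) * 32 ^ n)"
      by (simp add: sum_distrib_right)
    also have "\<dots> = 64 ^ n" unfolding choose_row_sum by (simp flip: power_mult_distrib)
    finally have "u n \<le> 64 ^ n" .
    moreover have "u n \<ge> 0" unfolding u_def by (intro sum_nonneg) simp
    ultimately show ?thesis by simp
  qed
  then have "real_of_int \<bar>u n\<bar> \<le> real_of_int (64 ^ n)" by (simp only: of_int_le_iff)
  then have "norm (u_monom n t) \<le> 64 ^ n * (1 / 128) ^ n"
    unfolding u_monom_def norm_mult norm_power using assms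
    by (intro mult_mono power_mono) auto
  also have "\<dots> = (1 / 2) ^ n" by (simp flip: power_mult_distrib)
  finally show ?thesis .
qed

lemma u_has_fps_expansion: "(\<lambda>t. \<Sum>n. u_monom n t) has_fps_expansion u_fps"
proof -
  have "(\<lambda>x. \<Sum>n. u_monom n x) has_fps_expansion
      Abs_fps (\<lambda>m. \<Sum>n\<le>m. fps_nth (fps_const (of_int (u n)) * fps_X ^ n) m)"
  proof (rule suminf_has_fps_expansion[where r = "1 / 128", OF _ _ _ summable_half])
    show "u_monom n holomorphic_on ball 0 (1 / 128)" for n
      unfolding u_monom_def by (intro holomorphic_intros)
    show "u_monom n has_fps_expansion fps_const (of_int (u n)) * fps_X ^ n" for n
      unfolding u_monom_def by (intro fps_expansion_intros)
  qed (use norm_u_monom in auto)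
  also have "Abs_fps (\<lambda>m. \<Sum>n\<le>m. fps_nth (fps_const (of_int (u n)) * fps_X ^ n) m) = u_fps"
    by (rule fps_ext) (simp add: u_fps_def if_distrib cong: if_cong)
  finally show ?thesis .
qed

text \<open>Since \<open>den + v = (1 + 2*v) * (1 + 4*v)\<close>, the factor \<open>1 + x\<close>
  contributes \<open>(1 + 2*v) * lin / den\<close>; with the \<open>den / lin^2\<close> of
  \<open>compose_identity\<close> this leaves \<open>(1 + 2*v) / lin\<close>.\<close>

lemma composition_identity:
  "(1 + fps_X) * lhs_fps oo x_fps = (1 + 2 * fps_X) * inverse lin * (u_fps oo t_fps)"
proof -
  let ?v = "fps_X :: complex fps"
  have qi: "lin * inverse lin = 1" by (rule inverse_mult_eq_1') (simp add: lin_0)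
  have c: "(1 + ?v) * lhs_fps oo x_fps = (1 + x_fps) * (lhs_fps oo x_fps)"
    by (simp add: compose_simps x_fps_0)
  have p: "den + ?v = (1 + 2 * ?v) * lin" unfolding den_def lin_def by algebra
  have "(lin^2 * den) * ((1 + x_fps) * (lhs_fps oo x_fps)) = (den + den * x_fps) * (lin^2 * (lhs_fps oo x_fps))"
    by algebra
  also have "\<dots> = (1 + 2 * ?v) * lin * den * (u_fps oo t_fps)"
    unfolding x_fps p compose_identity by algebra
  also have "\<dots> = (lin^2 * den) * ((1 + 2 * ?v) * inverse lin * (u_fps oo t_fps))"
    using qi by algebra
  finally have "(lin^2 * den) * ((1 + x_fps) * (lhs_fps oo x_fps)) = (lin^2 * den) * ((1 + 2 * ?v) * inverse lin * (u_fps oo t_fps))" .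
  moreover have "lin \<noteq> 0" "den \<noteq> 0" using lin_0 den_0 by auto
  then have "lin^2 * den \<noteq> 0" by simp
  ultimately show ?thesis unfolding c by (metis mult_left_cancel)
qed

lemma generating_function_identity:
  "\<exists>\<epsilon>::real. \<epsilon> > 0 \<and> (\<forall>v::complex. norm v < \<epsilon> \<longrightarrow>
          summable (lhs_term v) \<and> summable (rhs_term v) \<and>
          (\<Sum>n. lhs_term v n) = (1 + 2 * v) / (1 + 4 * v) * (\<Sum>n. rhs_term v n))"
proof -
  define t where "t = (\<lambda>v::complex. v / (1 + 4 * v)^3)"
  have x: "x_of has_fps_expansion x_fps"
  proof -
    have "(\<lambda>v::complex. v * inverse (1 + 5 * v + 8 * v^2)) has_fps_expansion
        fps_X * inverse (1 + 5 * fps_X + 8 * fps_X^2)"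
      by (intro fps_expansion_intros) (simp add: numeral_fps_const)
    also have "(\<lambda>v::complex. v * inverse (1 + 5 * v + 8 * v^2)) = x_of"
      by (simp add: x_of_def fun_eq_iff divide_inverse)
    finally show ?thesis by (simp add: x_fps_def den_def)
  qed
  have q: "(\<lambda>v::complex. inverse (1 + 4 * v)) has_fps_expansion inverse lin"
    unfolding lin_def by (intro fps_expansion_intros) (simp add: numeral_fps_const)
  have t: "t has_fps_expansion t_fps"
  proof -
    have "(\<lambda>v::complex. v * inverse (1 + 4 * v) ^ 3) has_fps_expansion t_fps"
      unfolding t_fps_def by (intro fps_expansion_intros q)
    then show ?thesis by (simp add: t_def divide_inverse power_inverse)
  qed
  have L: "(\<lambda>v. \<Sum>n. lhs_term v n) has_fps_expansion ((1 + fps_X) * lhs_fps oo x_fps)"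
    using has_fps_expansion_compose[OF gl_has_fps_expansion x x_fps_0]
    by (simp add: o_def lhs_term_eq)
  have R0: "(\<lambda>v. \<Sum>n. rhs_term v n) has_fps_expansion (u_fps oo t_fps)"
    using has_fps_expansion_compose[OF u_has_fps_expansion t t_fps_0]
    by (simp add: o_def rhs_term_def u_monom_def t_def)
  have R: "(\<lambda>v. (1 + 2 * v) * inverse (1 + 4 * v) * (\<Sum>n. rhs_term v n)) has_fps_expansion ((1 + fps_X) * lhs_fps oo x_fps)"
    unfolding composition_identity by (intro fps_expansion_intros q R0)
  \<comment> \<open>Both functions were given the same formal expansion, so near \<open>0\<close>
    each equals its evaluation.\<close>
  have eq: "eventually (\<lambda>v. (\<Sum>n. lhs_term v n) = (1 + 2 * v) * inverse (1 + 4 * v) * (\<Sum>n. rhs_term v n)) (nhds 0)"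
  proof -
    have "eventually (\<lambda>v. eval_fps ((1 + fps_X) * lhs_fps oo x_fps) v = (\<Sum>n. lhs_term v n)) (nhds 0)"
      "eventually (\<lambda>v. eval_fps ((1 + fps_X) * lhs_fps oo x_fps) v = (1 + 2 * v) * inverse (1 + 4 * v) * (\<Sum>n. rhs_term v n)) (nhds 0)"
      using L R unfolding has_fps_expansion_def by blast+
    then show ?thesis by eventually_elim simp
  qed
  have small_ball: "eventually (\<lambda>v. norm (h v) < r) (nhds 0)"
    if "h has_fps_expansion H" "h 0 = 0" "r > 0" for h :: "complex \<Rightarrow> complex" and H r
  proof -
    have "isCont h 0" using has_fps_expansion_imp_continuous[OF that(1)] .
    then have "(h \<longlongrightarrow> h 0) (nhds 0)"
      unfolding isCont_def tendsto_at_iff_tendsto_nhds .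
    then have "(h \<longlongrightarrow> 0) (nhds 0)" unfolding that(2) .
    from tendstoD[OF this that(3)] show ?thesis by simp
  qed
  \<comment> \<open>The thresholds are the radii of \<open>norm_gl_term\<close> and
    \<open>norm_u_monom\<close>, which yield the two summability claims.\<close>
  have "eventually (\<lambda>v. norm (x_of v) < 1 / 1024) (nhds 0)"
    by (rule small_ball[OF x]) (simp_all add: x_of_def)
  moreover have "eventually (\<lambda>v. norm (t v) < 1 / 128) (nhds 0)"
    by (rule small_ball[OF t]) (simp_all add: t_def)
  ultimately have "eventually (\<lambda>v. summable (lhs_term v) \<and> summable (rhs_term v) \<and>
      (\<Sum>n. lhs_term v n) = (1 + 2 * v) / (1 + 4 * v) * (\<Sum>n. rhs_term v n)) (nhds 0)"
    using eq
  proof eventually_elim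
    case (elim v)
    have "summable (\<lambda>n. gl_term n (x_of v))"
      by (rule summable_comparison_test'[OF summable_half]) (use norm_gl_term elim in auto)
    moreover have "summable (\<lambda>n. u_monom n (t v))"
      by (rule summable_comparison_test'[OF summable_half]) (use norm_u_monom elim in auto)
    moreover have "lhs_term v = (\<lambda>n. gl_term n (x_of v))" "rhs_term v = (\<lambda>n. u_monom n (t v))"
      by (simp_all add: fun_eq_iff lhs_term_eq rhs_term_def u_monom_def t_def)
    ultimately show ?case
      using elim(3) unfolding divide_inverse by simp
  qed
  then show ?thesis
    unfolding eventually_nhds_metric dist_norm diff_zero .
qed

section \<open>The closed form of \<open>z_of\<close>, and assembly\<close>

lemma z_of_eq:
  assumes "1 + 5 * v + 8 * v^2 \<noteq> 0"
  shows "z_of v = v * (1 + 5 * v + 8 * v^2) / ((1 + 2 * v)^2 * (1 + 4 * v)^2)"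
proof -
  define p where "p = 1 + 5 * v + 8 * v^2"
  have p: "p \<noteq> 0" using assms by (simp add: p_def)
  have x: "x_of v = v / p" by (simp add: x_of_def p_def)
  have "1 + x_of v = (p + v) / p"
    unfolding x using p by (simp add: add_divide_distrib)
  also have "p + v = (1 + 2 * v) * (1 + 4 * v)" unfolding p_def by algebra
  finally have "z_of v = (v / p) / ((1 + 2 * v) * (1 + 4 * v) / p)^2"
    by (simp add: z_of_def x)
  also have "\<dots> = v * p / ((1 + 2 * v)^2 * (1 + 4 * v)^2)"
    using p by (simp add: power_divide power_mult_distrib power2_eq_square)
  finally show ?thesis by (simp add: p_def)
qed

theorem theorem1:
  shows "(\<forall>n::nat. u n = (\<Sum>k=0..n. (- 1)^(n - k) * int ((3 * n + 1) choose (n - k)) * int ((n + k) choose n)^3))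
    \<and> u 0 = 1
    \<and> (\<forall>n::nat. (int n + 1)^3 * u (n + 1) =
          (2 * int n + 1) * (13 * (int n)^2 + 13 * int n + 4) * u n
          + 3 * int n * (3 * int n - 1) * (3 * int n + 1) * (if n = 0 then 0 else u (n - 1)))
    \<and> (\<forall>v::complex. 1 + 5 * v + 8 * v^2 \<noteq> 0 \<longrightarrow> 1 + 2 * v \<noteq> 0 \<longrightarrow> 1 + 4 * v \<noteq> 0 \<longrightarrow>
          z_of v = v * (1 + 5 * v + 8 * v^2) / ((1 + 2 * v)^2 * (1 + 4 * v)^2))
    \<and> (\<exists>\<epsilon>::real. \<epsilon> > 0 \<and> (\<forall>v::complex. norm v < \<epsilon> \<longrightarrow>
          summable (lhs_term v) \<and> summable (rhs_term v) \<and>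
          (\<Sum>n. lhs_term v n) = (1 + 2 * v) / (1 + 4 * v) * (\<Sum>n. rhs_term v n)))"
proof (intro conjI)
  show "u 0 = 1" by (simp add: u_def)
qed (use u_eq_alternating_sum u_recurrence z_of_eq generating_function_identity in \<open>blast+\<close>)

end
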